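(* Let $k/k_0$ be a quadratic extension of number fields, with $k\subseteq\mathbb{C}$, whose nontrivial automorphism is given by complex conjugation. Let $B=(\xi,L/k,G)$ be a crossed product division algebra, where $L/k$ is a finite Galois extension with Galois group $G$ and $\xi$ is a $2$-cocycle of $G$ with values in $L$. Assume that $L\subseteq\mathbb{C}$ and that complex conjugation induces an automorphism $\alpha$ of $L$. Assume that $\alpha(\xi_{\sigma,\rho})\,\xi_{\sigma,\rho}=1$ for all $\sigma,\rho\in G$. If $B$ carries a positive unitary involution $\tau$ such that $\tau|_L=\alpha$, then $\tau|_L$ commutes with all elements of $G$.
   Context: Crossed product: for a finite Galois extension $L/k$ with group $G$ and a $2$-cocycle $\xi:G\times G\to L^\times$, $(\sigma,\rho)\mapsto\xi_{\sigma,\rho}$, the algebra $(\xi,L/k,G)$ is the central simple $k$-algebra $\bigoplus_{\sigma\in G}L e_\sigma$ with generators $e_\sigma$ ($\sigma\in G$) and multiplication determined by $e_\sigma\lambda=\sigma(\lambda)e_\sigma$ for $\lambda\in L$ and $e_\sigma e_\rho=\xi_{\sigma,\rho}e_{\sigma\rho}$. It contains $L$ as a subfield. "Crossed product division algebra" means that $B$ is moreover a division algebra. Here $k\subseteq L\subseteq\mathbb{C}$, and $k_0=k\cap\mathbb{R}$ is a subfield of $\mathbb{R}$; the only ordering on $k_0$ considered is the one induced by the standard ordering of $\mathbb{R}$. A unitary involution on $B$ is a ring anti-automorphism $\tau$ of $B$ with $\tau^2=\mathrm{id}$ whose restriction to $k$ is the nontrivial automorphism of $k/k_0$ (complex conjugation).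 Let $\mathrm{Trd}_B$ denote the reduced trace of $B$. A unitary involution $\tau$ is positive (equivalently, positive definite) if the involution trace form $x\mapsto\mathrm{Trd}_B(\tau(x)x)$, which takes values in $k_0\subseteq\mathbb{R}$, is positive definite with respect to this ordering, i.e. $\mathrm{Trd}_B(\tau(x)x)>0$ for every nonzero $x\in B$. *)

theory Defs
  imports
    Complex_Main
    "HOL-Algebra.Algebra"
    "HOL-Algebra.Algebraic_Closure_Type"
    "Jordan_Normal_Form.Matrix"
begin

section \<open>Subfields of the complex numbers\<close>

abbreviation CC :: "complex ring" where
  "CC \<equiv> ring_of_type_algebra"

definition number_field :: "complex set \<Rightarrow> bool" where
  "number_field K \<longleftrightarrow> subfield K CC \<and> ring.finite_dimension CC \<rat> K"

text \<open>
  Automorphisms of \<open>L\<close> are represented by extensional functions, so that they are equal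
  as HOL functions if and only if they agree on \<open>L\<close>.
\<close>

definition field_auts :: "complex set \<Rightarrow> (complex \<Rightarrow> complex) set" where
  "field_auts L = extensional L \<inter> ring_iso (CC\<lparr>carrier := L\<rparr>) (CC\<lparr>carrier := L\<rparr>)"

definition galois_group :: "complex set \<Rightarrow> complex set \<Rightarrow> (complex \<Rightarrow> complex) monoid" where
  "galois_group L k =
     BijGroup L \<lparr>carrier := {\<sigma> \<in> field_auts L. \<forall>c\<in>k. \<sigma> c = c}\<rparr>"

definition finite_galois_extension :: "complex set \<Rightarrow> complex set \<Rightarrow> bool" where
  "finite_galois_extension L k \<longleftrightarrow>
     subfield k CC \<and> subfield L CC \<and> k \<subseteq> L \<and> ring.finite_dimension CC k L \<and>
     {x \<in> L. \<forall>\<sigma>\<in>carrier (galois_group L k). \<sigma> x = x} = k"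


section \<open>Crossed products\<close>

text \<open>
  The cocycle identity is associativity of \<open>(e\<^sub>\<sigma> e\<^sub>\<rho>) e\<^sub>\<pi> = e\<^sub>\<sigma> (e\<^sub>\<rho> e\<^sub>\<pi>)\<close>. Cocycles are not assumed
  to be normalized.
\<close>

definition two_cocycle ::
    "complex set \<Rightarrow> complex set \<Rightarrow>
     ((complex \<Rightarrow> complex) \<Rightarrow> (complex \<Rightarrow> complex) \<Rightarrow> complex) \<Rightarrow> bool" where
  "two_cocycle L k \<xi> \<longleftrightarrow>
     (let G = galois_group L k in
       (\<forall>\<sigma>\<in>carrier G. \<forall>\<rho>\<in>carrier G. \<xi> \<sigma> \<rho> \<in> L - {0}) \<and>
       (\<forall>\<sigma>\<in>carrier G. \<forall>\<rho>\<in>carrier G. \<forall>\<pi>\<in>carrier G.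
          \<xi> \<sigma> \<rho> * \<xi> (\<sigma> \<otimes>\<^bsub>G\<^esub> \<rho>) \<pi> = \<sigma> (\<xi> \<rho> \<pi>) * \<xi> \<sigma> (\<rho> \<otimes>\<^bsub>G\<^esub> \<pi>)))"

text \<open>The element \<open>\<lambda> e\<^sub>\<sigma>\<close>; a general element \<open>\<Sum>\<^sub>\<sigma> x\<^sub>\<sigma> e\<^sub>\<sigma>\<close> is the family \<open>x\<close> of its coefficients.\<close>

definition cp_monom ::
    "complex set \<Rightarrow> complex set \<Rightarrow> complex \<Rightarrow> (complex \<Rightarrow> complex) \<Rightarrow>
     ((complex \<Rightarrow> complex) \<Rightarrow> complex)" where
  "cp_monom L k c \<sigma> = (\<lambda>\<pi>\<in>carrier (galois_group L k). if \<pi> = \<sigma> then c else 0)"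

text \<open>
  The embedding of \<open>L\<close> in \<open>(\<xi>, L/k, G)\<close>. As \<open>\<xi>\<close> need not be normalized, the unit of the
  algebra is \<open>\<xi>\<^sub>1\<^sub>,\<^sub>1\<^sup>-\<^sup>1 e\<^sub>1\<close>.
\<close>

definition cp_embed ::
    "((complex \<Rightarrow> complex) \<Rightarrow> (complex \<Rightarrow> complex) \<Rightarrow> complex) \<Rightarrow> complex set \<Rightarrow> complex set \<Rightarrow>
     complex \<Rightarrow> ((complex \<Rightarrow> complex) \<Rightarrow> complex)" where
  "cp_embed \<xi> L k c =
     (let G = galois_group L k in cp_monom L k (c / \<xi> \<one>\<^bsub>G\<^esub> \<one>\<^bsub>G\<^esub>) \<one>\<^bsub>G\<^esub>)"

definition crossed_product ::
    "((complex \<Rightarrow> complex) \<Rightarrow> (complex \<Rightarrow> complex) \<Rightarrow> complex) \<Rightarrow> complex set \<Rightarrow> complex set \<Rightarrow>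
     ((complex \<Rightarrow> complex) \<Rightarrow> complex) ring" where
  "crossed_product \<xi> L k =
     (let G = galois_group L k in
       \<lparr>carrier = carrier G \<rightarrow>\<^sub>E L,
        monoid.mult = (\<lambda>x y. \<lambda>\<pi>\<in>carrier G.
          \<Sum>(\<sigma>, \<rho>) \<in> {(\<sigma>, \<rho>) \<in> carrier G \<times> carrier G. \<sigma> \<otimes>\<^bsub>G\<^esub> \<rho> = \<pi>}.
            x \<sigma> * \<sigma> (y \<rho>) * \<xi> \<sigma> \<rho>),
        one = cp_embed \<xi> L k 1,
        ring.zero = (\<lambda>\<pi>\<in>carrier G. 0),
        add = (\<lambda>x y. \<lambda>\<pi>\<in>carrier G. x \<pi> + y \<pi>)\<rparr>)"

lemma cp_monom_mult:
  assumes "finite (carrier (galois_group L k))"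
    and "\<sigma> \<in> carrier (galois_group L k)" "\<rho> \<in> carrier (galois_group L k)"
    and "0 \<in> L"
  shows "cp_monom L k a \<sigma> \<otimes>\<^bsub>crossed_product \<xi> L k\<^esub> cp_monom L k b \<rho> =
         cp_monom L k (a * \<sigma> b * \<xi> \<sigma> \<rho>) (\<sigma> \<otimes>\<^bsub>galois_group L k\<^esub> \<rho>)"
proof -
  let ?G = "galois_group L k"
  have hom0: "s 0 = 0" if s: "s \<in> carrier ?G" for s
  proof -
    have "s \<in> Ring.ring_hom (CC\<lparr>carrier := L\<rparr>) (CC\<lparr>carrier := L\<rparr>)"
      using s by (auto simp: galois_group_def field_auts_def ring_iso_def)
    from ring_hom_add[OF this, of 0 0] show ?thesis
      using \<open>0 \<in> L\<close> by (simp add: ring_of_type_algebra_def)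
  qed
  have "(\<Sum>(s, r) \<in> {(s, r) \<in> carrier ?G \<times> carrier ?G. s \<otimes>\<^bsub>?G\<^esub> r = p}.
            cp_monom L k a \<sigma> s * s (cp_monom L k b \<rho> r) * \<xi> s r) =
        (if p = \<sigma> \<otimes>\<^bsub>?G\<^esub> \<rho> then a * \<sigma> b * \<xi> \<sigma> \<rho> else 0)" for p
  proof -
    let ?S = "{(s, r) \<in> carrier ?G \<times> carrier ?G. s \<otimes>\<^bsub>?G\<^esub> r = p}"
    have fin: "finite ?S"
      by (rule finite_subset[of _ "carrier ?G \<times> carrier ?G"]) (use assms(1) in auto)
    have "(\<Sum>(s, r) \<in> ?S. cp_monom L k a \<sigma> s * s (cp_monom L k b \<rho> r) * \<xi> s r) =
          (\<Sum>z \<in> ?S. if z = (\<sigma>, \<rho>) then a * \<sigma> b * \<xi> \<sigma> \<rho> else 0)"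
      by (rule sum.cong) (auto simp: cp_monom_def hom0 split: if_splits)
    also have "\<dots> = (if p = \<sigma> \<otimes>\<^bsub>?G\<^esub> \<rho> then a * \<sigma> b * \<xi> \<sigma> \<rho> else 0)"
      using assms(2,3) fin by (auto simp: sum.delta)
    finally show ?thesis .
  qed
  then show ?thesis
    by (auto simp: crossed_product_def Let_def cp_monom_def[of _ _ _ "\<sigma> \<otimes>\<^bsub>?G\<^esub> \<rho>"]
        intro!: restrict_ext)
qed

definition skew_field :: "('a, 'b) ring_scheme \<Rightarrow> bool" where
  "skew_field R \<longleftrightarrow> ring R \<and> Units R = carrier R - {\<zero>\<^bsub>R\<^esub>}"


section \<open>Reduced trace\<close>

text \<open>
  A \<open>k\<close>-algebra \<open>B\<close>, \<open>k \<subseteq> \<complex>\<close>, is given by a ring together with its structure map \<open>\<iota>\<close>, so that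
  linear independence and spans over \<open>k\<close> are those over the subring \<open>\<iota> ` k\<close>.
\<close>

definition k_basis :: "('a, 'b) ring_scheme \<Rightarrow> 'a set \<Rightarrow> 'a list \<Rightarrow> bool" where
  "k_basis R K bs \<longleftrightarrow>
     set bs \<subseteq> carrier R \<and> ring.independent R K bs \<and> ring.Span R K bs = carrier R"

text \<open>
  The last clause says that the \<open>\<complex>\<close>-linear extension \<open>\<complex> \<otimes>\<^sub>k B \<rightarrow> M\<^sub>n(\<complex>)\<close> of \<open>\<phi>\<close> is
  bijective, hence an isomorphism of \<open>\<complex>\<close>-algebras.
\<close>

definition splitting ::
    "complex set \<Rightarrow> (complex \<Rightarrow> 'a) \<Rightarrow> ('a, 'b) ring_scheme \<Rightarrow> nat \<Rightarrow> ('a \<Rightarrow> complex mat) \<Rightarrow> bool" where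
  "splitting k \<iota> B n \<phi> \<longleftrightarrow>
     (let M = ring_mat TYPE(complex) n () in
       \<phi> \<in> Ring.ring_hom B M \<and>
       (\<forall>c\<in>k. \<phi> (\<iota> c) = c \<cdot>\<^sub>m 1\<^sub>m n) \<and>
       (\<exists>bs. k_basis B (\<iota> ` k) bs \<and> k_basis M (range (\<lambda>c. c \<cdot>\<^sub>m 1\<^sub>m n)) (map \<phi> bs)))"

text \<open>
  The reduced trace of a central simple \<open>k\<close>-algebra, computed over the splitting field \<open>\<complex>\<close>
  of \<open>B\<close>; it does not depend on the splitting.
\<close>

definition Trd :: "complex set \<Rightarrow> (complex \<Rightarrow> 'a) \<Rightarrow> ('a, 'b) ring_scheme \<Rightarrow> 'a \<Rightarrow> complex" where
  "Trd k \<iota> B x = (THE t. \<exists>n \<phi>. splitting k \<iota> B n \<phi> \<and> t = (\<Sum>i<n. \<phi> x $$ (i, i)))"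


section \<open>Unitary involutions\<close>

definition opposite_ring :: "('a, 'b) ring_scheme \<Rightarrow> ('a, 'b) ring_scheme" where
  "opposite_ring R = R\<lparr>monoid.mult := (\<lambda>x y. y \<otimes>\<^bsub>R\<^esub> x)\<rparr>"

text \<open>Here the nontrivial automorphism of \<open>k\<close> over \<open>k \<inter> \<real>\<close> is complex conjugation.\<close>

definition unitary_involution ::
    "complex set \<Rightarrow> (complex \<Rightarrow> 'a) \<Rightarrow> ('a, 'b) ring_scheme \<Rightarrow> ('a \<Rightarrow> 'a) \<Rightarrow> bool" where
  "unitary_involution k \<iota> B \<tau> \<longleftrightarrow>
     \<tau> \<in> ring_iso B (opposite_ring B) \<and>
     (\<forall>x\<in>carrier B. \<tau> (\<tau> x) = x) \<and>
     (\<forall>c\<in>k. \<tau> (\<iota> c) = \<iota> (cnj c))"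

definition positive_involution ::
    "complex set \<Rightarrow> (complex \<Rightarrow> 'a) \<Rightarrow> ('a, 'b) ring_scheme \<Rightarrow> ('a \<Rightarrow> 'a) \<Rightarrow> bool" where
  "positive_involution k \<iota> B \<tau> \<longleftrightarrow>
     (\<forall>x\<in>carrier B - {\<zero>\<^bsub>B\<^esub>}. \<exists>r::real. r > 0 \<and> Trd k \<iota> B (\<tau> x \<otimes>\<^bsub>B\<^esub> x) = complex_of_real r)"

end

theory Submission
  imports Defs
begin

text \<open>
  For \<open>x \<in> L\<close> the reduced trace of \<open>\<tau>(x) x\<close> is \<open>Tr\<^bsub>L/k\<^esub>(cnj x * x) = \<Sum>\<^sub>\<sigma> cnj (\<sigma>' x) * \<sigma> x\<close>, where
  \<open>\<sigma>' = cnj \<sigma> cnj\<close>. By interpolation, and because \<open>k\<close> is dense in \<open>\<complex>\<close>, the vectors \<open>(\<sigma> x)\<^sub>\<sigma>\<close> with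
  \<open>x \<in> L\<close> are dense in \<open>\<complex>\<^sup>G\<close>. Hence positivity on \<open>L\<close> makes the Hermitian form
  \<open>\<Sum>\<^sub>\<sigma> cnj (v \<sigma>') * v \<sigma>\<close> positive semidefinite. If \<open>\<sigma>' \<noteq> \<sigma>\<close>, it is
  negative at the difference of the indicators of \<open>\<sigma>\<close> and \<open>\<sigma>'\<close>.

  The reduced trace is computed in the regular representation of \<open>B\<close> on a right \<open>L\<close>-vector space.
  Any other splitting gives the same value on \<open>L\<close>, since \<open>y\<close> and \<open>\<sigma> y\<close> are conjugate in \<open>B\<close> and
  the sum of all \<open>\<sigma> y\<close> is a scalar.
\<close>

section \<open>Linear algebra over subfields of the complex numbers\<close>

text \<open>The obstacle is \<open>Trd\<close>: it is a definite description ranging over all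
  splittings of all degrees, so evaluating it on \<open>\<iota> y\<close> takes one explicit
  splitting and a proof that every other one agrees there. For existence, the image of a
  \<open>k\<close>-basis \<open>b l e_\<sigma>\<close> of \<open>B\<close> must be a complex basis
  of the full matrix algebra. The matrix positions sort themselves by \<open>\<sigma>\<close>, and
  for each \<open>\<sigma>\<close> the question is whether the matrix with entries
  \<open>\<kappa> (b l)\<close> is invertible. Interpolation gives solvability, and the
  nondegenerate trace form gives uniqueness. For agreement, the value on a scalar depends on the
  matrix size, so the degree of a splitting has to be pinned down by comparing dimensions. In the
  positivity argument, passing to limits weakens strict inequalities. The test vector must therefore
  have a strictly negative value. It is odd under the involution
  \<open>\<sigma> \<mapsto> \<sigma>'\<close> of \<open>G\<close>, which makes the Hermitian form
  equal to minus the squared norm there.\<close>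

lemma CC_simps [simp]:
  "carrier CC = UNIV" "\<zero>\<^bsub>CC\<^esub> = 0" "\<one>\<^bsub>CC\<^esub> = 1"
  "x \<otimes>\<^bsub>CC\<^esub> y = x * y" "x \<oplus>\<^bsub>CC\<^esub> y = x + y"
  by (simp_all add: ring_of_type_algebra_def)

lemma ring_CC: "ring CC"
  by (rule ring_from_type_algebra)

lemma CC_a_inv [simp]: "\<ominus>\<^bsub>CC\<^esub> x = - x"
proof -
  interpret ring CC by (rule ring_CC)
  show ?thesis by (rule minus_equality) auto
qed

lemma subfield_CC:
  assumes "subfield K CC"
  shows "0 \<in> K" "1 \<in> K" "\<And>x y. x \<in> K \<Longrightarrow> y \<in> K \<Longrightarrow> x + y \<in> K"
    "\<And>x y. x \<in> K \<Longrightarrow> y \<in> K \<Longrightarrow> x * y \<in> K" "\<And>x. x \<in> K \<Longrightarrow> - x \<in> K"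
    "\<And>x y. x \<in> K \<Longrightarrow> y \<in> K \<Longrightarrow> x - y \<in> K"
    "\<And>x. x \<in> K \<Longrightarrow> inverse x \<in> K" "\<And>x y. x \<in> K \<Longrightarrow> y \<in> K \<Longrightarrow> x / y \<in> K"
proof -
  interpret ring CC by (rule ring_CC)
  note p = subringE[OF subfieldE(1)[OF assms]]
  show 0: "0 \<in> K" and "1 \<in> K" and add: "\<And>x y. x \<in> K \<Longrightarrow> y \<in> K \<Longrightarrow> x + y \<in> K"
    and mult: "\<And>x y. x \<in> K \<Longrightarrow> y \<in> K \<Longrightarrow> x * y \<in> K"
    and uminus: "\<And>x. x \<in> K \<Longrightarrow> - x \<in> K"
    using p by auto
  show "\<And>x y. x \<in> K \<Longrightarrow> y \<in> K \<Longrightarrow> x - y \<in> K"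
    using add uminus by (metis diff_conv_add_uminus)
  show inverse: "inverse x \<in> K" if "x \<in> K" for x
  proof (cases "x = 0")
    case False
    then have "x * inv\<^bsub>CC\<^esub> x = 1" "inv\<^bsub>CC\<^esub> x \<in> K"
      using subfield_m_inv[OF assms, of x] that by auto
    then show ?thesis by (metis inverse_unique)
  qed (use 0 in auto)
  show "\<And>x y. x \<in> K \<Longrightarrow> y \<in> K \<Longrightarrow> x / y \<in> K"
    using inverse mult by (simp add: divide_inverse)
qed

lemma subfield_CC_sum:
  assumes "subfield K CC" "\<And>i. i \<in> I \<Longrightarrow> f i \<in> K"
  shows "sum f I \<in> K"
  using assms(2) by (induction I rule: infinite_finite_induct) (auto simp: subfield_CC[OF assms(1)])

lemma subfield_CC_Rats:
  assumes "subfield K CC" "q \<in> \<rat>"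
  shows "q \<in> K"
proof -
  have nat: "of_nat n \<in> K" for n
    by (induction n) (auto simp: subfield_CC[OF assms(1)])
  have "of_int n \<in> K" for n
    by (cases n rule: int_cases2) (auto simp: subfield_CC[OF assms(1)] nat)
  moreover obtain a b where "q = of_int a / of_int b"
    using assms(2) by (auto elim: Rats_cases')
  ultimately show ?thesis by (auto simp: subfield_CC[OF assms(1)])
qed

text \<open>A finite form of Stone-Weierstrass, by Lagrange interpolation. It serves twice: for the
  complex span of the evaluations \<open>\<sigma> \<mapsto> \<sigma> x\<close>, and for the set of
  their pointwise limits.\<close>

lemma separating_algebra_interpolates:
  fixes A :: "('s \<Rightarrow> complex) set"
  assumes fin: "finite S"
    and const: "\<And>c. (\<lambda>_. c) \<in> A"
    and add: "\<And>f g. f \<in> A \<Longrightarrow> g \<in> A \<Longrightarrow> (\<lambda>s. f s + g s) \<in> A"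
    and mult: "\<And>f g. f \<in> A \<Longrightarrow> g \<in> A \<Longrightarrow> (\<lambda>s. f s * g s) \<in> A"
    and sep: "\<And>s t. s \<in> S \<Longrightarrow> t \<in> S \<Longrightarrow> s \<noteq> t \<Longrightarrow> \<exists>f\<in>A. f s \<noteq> f t"
  shows "\<exists>f\<in>A. \<forall>s\<in>S. f s = v s"
proof -
  have sumA: "(\<lambda>s. \<Sum>t\<in>T. f t s) \<in> A" if "\<And>t. t \<in> T \<Longrightarrow> f t \<in> A" for T :: "'s set" and f
    using that by (induction T rule: infinite_finite_induct) (auto simp: const intro: add)
  have prodA: "(\<lambda>s. \<Prod>t\<in>T. f t s) \<in> A" if "\<And>t. t \<in> T \<Longrightarrow> f t \<in> A" for T :: "'s set" and f
    using that by (induction T rule: infinite_finite_induct) (auto simp: const intro: mult)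
  have "\<forall>s t. \<exists>f. s \<in> S \<longrightarrow> t \<in> S \<longrightarrow> s \<noteq> t \<longrightarrow> f \<in> A \<and> f s \<noteq> f t"
    using sep by blast
  then obtain h where h: "\<And>s t. s \<in> S \<Longrightarrow> t \<in> S \<Longrightarrow> s \<noteq> t \<Longrightarrow> h s t \<in> A \<and> h s t s \<noteq> h s t t"
    by metis
  \<comment> \<open>Lagrange basis function of the node \<open>s\<close>: every other node
    \<open>t\<close> contributes a factor built from its own separating function, equal to 0 at
    \<open>t\<close> and to 1 at \<open>s\<close>.\<close>
  define l where "l s = (\<lambda>x. \<Prod>t\<in>S - {s}. (h s t x + - h s t t) * inverse (h s t s - h s t t))" for s
  have "l s \<in> A" if "s \<in> S" for s
    unfolding l_def using h[OF that] by (intro prodA mult add const) auto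
  then have "(\<lambda>x. \<Sum>s\<in>S. v s * l s x) \<in> A"
    by (intro sumA mult const) auto
  moreover have l: "l s x = (if x = s then 1 else 0)" if "s \<in> S" "x \<in> S" for s x
  proof (cases "x = s")
    case True
    have "h s t s - h s t t \<noteq> 0" if "t \<in> S - {s}" for t
      using h[OF \<open>s \<in> S\<close>, of t] that by auto
    then show ?thesis using True by (simp add: l_def)
  next
    case False
    then show ?thesis
      using that fin by (auto simp: l_def intro!: prod_zero)
  qed
  have "(\<Sum>s\<in>S. v s * l s x) = v x" if "x \<in> S" for x
  proof -
    have "(\<Sum>s\<in>S. v s * l s x) = (\<Sum>s\<in>S. if s = x then v x else 0)"
      using that by (intro sum.cong) (auto simp: l)
    also have "\<dots> = v x"
      by (subst sum.delta) (simp_all add: fin that)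
    finally show ?thesis .
  qed
  ultimately show ?thesis
    by (intro bexI[of _ "\<lambda>x. \<Sum>s\<in>S. v s * l s x"]) simp_all
qed

text \<open>Gaussian elimination: a pivot vector clears the last coordinate of the other vectors,
  which costs one vector and one coordinate.\<close>

lemma linear_relation_exists:
  fixes f :: "'j \<Rightarrow> nat \<Rightarrow> complex"
  assumes "finite J" "m < card J"
  shows "\<exists>d. (\<exists>j\<in>J. d j \<noteq> 0) \<and> (\<forall>i<m. (\<Sum>j\<in>J. d j * f j i) = 0)"
  using assms
proof (induction m arbitrary: f J)
  case 0
  then obtain j where "j \<in> J" by (metis card.empty all_not_in_conv less_irrefl)
  then show ?case by (intro exI[of _ "\<lambda>_. 1"]) auto
next
  case (Suc m)
  show ?case
  proof (cases "\<forall>j\<in>J. f j m = 0")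
    case True
    obtain d where "\<exists>j\<in>J. d j \<noteq> 0" "\<forall>i<m. (\<Sum>j\<in>J. d j * f j i) = 0"
      using Suc.IH[of J f] Suc.prems by auto
    with True show ?thesis by (intro exI[of _ d]) (auto simp: less_Suc_eq)
  next
    case False
    then obtain p where p: "p \<in> J" "f p m \<noteq> 0" by blast
    have card: "m < card (J - {p})"
      using Suc.prems p by simp
    obtain d where d: "\<exists>j\<in>J - {p}. d j \<noteq> 0"
      "\<forall>i<m. (\<Sum>j\<in>J - {p}. d j * (f j i - f j m / f p m * f p i)) = 0"
      using Suc.IH[OF _ card, of "\<lambda>j i. f j i - f j m / f p m * f p i"] Suc.prems(1) by blast
    \<comment> \<open>Expanding the cleared vectors collects all multiples of \<open>f p\<close> in
      this one coefficient. Coordinate \<open>m\<close> then cancels because it is 0 in each cleared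
      vector.\<close>
    define e where "e = d(p := - (\<Sum>j\<in>J - {p}. d j * f j m) / f p m)"
    have sum_e: "(\<Sum>j\<in>J. e j * f j i) = (\<Sum>j\<in>J - {p}. d j * (f j i - f j m / f p m * f p i))" for i
    proof -
      have "(\<Sum>j\<in>J. e j * f j i) = e p * f p i + (\<Sum>j\<in>J - {p}. e j * f j i)"
        by (rule sum.remove) (use Suc.prems p in auto)
      also have "(\<Sum>j\<in>J - {p}. e j * f j i) = (\<Sum>j\<in>J - {p}. d j * f j i)"
        by (rule sum.cong) (auto simp: e_def)
      also have "e p * f p i = - (\<Sum>j\<in>J - {p}. d j * (f j m / f p m * f p i))"
        by (simp add: e_def sum_distrib_right sum_divide_distrib flip: sum_negf)
          (rule sum.cong; simp add: field_simps)
      finally show ?thesis by (simp add: algebra_simps sum_subtractf)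
    qed
    have "\<forall>i<Suc m. (\<Sum>j\<in>J. e j * f j i) = 0"
      using d(2) p by (auto simp: sum_e less_Suc_eq)
    moreover have "\<exists>j\<in>J. e j \<noteq> 0"
      using d(1) by (auto simp: e_def)
    ultimately show ?thesis by blast
  qed
qed

text \<open>Elimination performs only field operations on the coefficients, so it stays inside
  \<open>K\<close>. The induction is on the number of unknowns because the set \<open>S\<close> of
  equations may be infinite; it is applied with \<open>S = L\<close>.\<close>

lemma linear_relation_descends:
  fixes f :: "nat \<Rightarrow> 'x \<Rightarrow> complex"
  assumes K: "subfield K CC"
    and "\<And>i x. i < m \<Longrightarrow> x \<in> S \<Longrightarrow> f i x \<in> K"
    and "\<And>x. x \<in> S \<Longrightarrow> (\<Sum>i<m. c i * f i x) = 0"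
    and "\<exists>i<m. c i \<noteq> 0"
  shows "\<exists>d. (\<forall>i. d i \<in> K) \<and> (\<exists>i<m. d i \<noteq> 0) \<and> (\<forall>x\<in>S. (\<Sum>i<m. d i * f i x) = 0)"
  using assms(2-)
proof (induction m arbitrary: f)
  case (Suc m)
  note cl = subfield_CC[OF K]
  show ?case
  proof (cases "\<forall>x\<in>S. f m x = 0")
    case True
    then show ?thesis
      by (intro exI[of _ "\<lambda>i. if i = m then 1 else 0"]) (auto simp: cl)
  next
    case False
    then obtain p where p: "p \<in> S" "f m p \<noteq> 0" by blast
    \<comment> \<open>Equation \<open>p\<close> is solved for the unknown \<open>m\<close> and
      substituted into the others.\<close>
    define g where "g i x = f i x - f i p / f m p * f m x" for i x
    have relp: "(\<Sum>i<m. c i * f i p) = - c m * f m p"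
      using Suc.prems(2)[OF p(1)] by (simp add: add_eq_0_iff)
    have "(\<Sum>i<m. c i * g i x) = 0" if "x \<in> S" for x
    proof -
      have "(\<Sum>i<m. c i * g i x) = (\<Sum>i<m. c i * f i x) - (\<Sum>i<m. c i * f i p) / f m p * f m x"
        by (simp add: g_def algebra_simps sum_subtractf sum_distrib_left sum_divide_distrib)
      also have "\<dots> = 0"
        using Suc.prems(2)[OF that] p unfolding relp by simp
      finally show ?thesis .
    qed
    moreover have "\<exists>i<m. c i \<noteq> 0"
    proof (rule ccontr)
      assume "\<not> (\<exists>i<m. c i \<noteq> 0)"
      then have "c m * f m p = 0" "c m \<noteq> 0"
        using relp Suc.prems(3) by (auto simp: less_Suc_eq)
      with p show False by simp
    qed
    moreover have "g i x \<in> K" if "i < m" "x \<in> S" for i x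
      using Suc.prems(1) that p by (auto simp: g_def cl)
    ultimately obtain d where d: "\<forall>i. d i \<in> K" "\<exists>i<m. d i \<noteq> 0" "\<forall>x\<in>S. (\<Sum>i<m. d i * g i x) = 0"
      using Suc.IH[of g] by blast
    \<comment> \<open>Back substitution: the value of the unknown \<open>m\<close> that equation
      \<open>p\<close> forces.\<close>
    define e where "e = d(m := - (\<Sum>i<m. d i * f i p) / f m p)"
    have "(\<Sum>i<Suc m. e i * f i x) = (\<Sum>i<m. d i * g i x)" for x
      by (simp add: e_def g_def algebra_simps sum_subtractf sum_distrib_left sum_divide_distrib)
    moreover have "e i \<in> K" for i
      using d(1) Suc.prems(1) p by (auto simp: e_def intro!: cl subfield_CC_sum[OF K])
    moreover have "\<exists>i<Suc m. e i \<noteq> 0"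
      using d(2) by (auto simp: e_def less_Suc_eq)
    ultimately show ?thesis using d(3) by (intro exI[of _ e]) simp
  qed
qed auto

section \<open>Bases given by lists, rewritten as indexed sums of complex coordinates\<close>

lemma (in ring) additive_combine:
  fixes f :: "'a \<Rightarrow> complex"
  assumes f: "\<And>x y. x \<in> carrier R \<Longrightarrow> y \<in> carrier R \<Longrightarrow> f (x \<oplus> y) = f x + f y"
    and "length Ks = length Us" "set Ks \<subseteq> carrier R" "set Us \<subseteq> carrier R"
  shows "f (combine Ks Us) = (\<Sum>i<length Us. f (Ks ! i \<otimes> Us ! i))"
  using assms(2-)
proof (induction Ks Us rule: list_induct2)
  case Nil
  have "f \<zero> = f \<zero> + f \<zero>" using f[of \<zero> \<zero>] by simp
  then show ?case by simp
next
  case (Cons k Ks u Us)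
  then show ?case by (simp add: f sum.lessThan_Suc_shift del: sum.lessThan_Suc)
qed

text \<open>Equality in \<open>R\<close> is tested by a separating family \<open>\<Phi>\<close> of additive coordinate functions.\<close>

lemma k_basis_mapI:
  fixes R :: "('a, 'b) ring_scheme" (structure) and \<Phi> :: "('a \<Rightarrow> complex) set"
  assumes R: "ring R" and K: "subfield K R" and ps: "distinct ps"
    and v: "\<And>p. p \<in> set ps \<Longrightarrow> v p \<in> carrier R"
    and add: "\<And>f x y. f \<in> \<Phi> \<Longrightarrow> x \<in> carrier R \<Longrightarrow> y \<in> carrier R \<Longrightarrow> f (x \<oplus>\<^bsub>R\<^esub> y) = f x + f y"
    and sep: "\<And>x y. x \<in> carrier R \<Longrightarrow> y \<in> carrier R \<Longrightarrow> (\<And>f. f \<in> \<Phi> \<Longrightarrow> f x = f y) \<Longrightarrow> x = y"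
    and span: "\<And>x. x \<in> carrier R \<Longrightarrow>
      \<exists>c. c ` set ps \<subseteq> K \<and> (\<forall>f\<in>\<Phi>. f x = (\<Sum>p\<in>set ps. f (c p \<otimes>\<^bsub>R\<^esub> v p)))"
    and indep: "\<And>c p. c ` set ps \<subseteq> K \<Longrightarrow> (\<And>f. f \<in> \<Phi> \<Longrightarrow> (\<Sum>p\<in>set ps. f (c p \<otimes>\<^bsub>R\<^esub> v p)) = 0) \<Longrightarrow>
      p \<in> set ps \<Longrightarrow> c p = \<zero>\<^bsub>R\<^esub>"
  shows "k_basis R K (map v ps)"
proof -
  interpret ring R by fact
  have KR: "K \<subseteq> carrier R" using subfieldE(3)[OF K] .
  have vs: "set (map v ps) \<subseteq> carrier R" using v by auto
  have comb: "f (combine (map c ps) (map v ps)) = (\<Sum>p\<in>set ps. f (c p \<otimes> v p))"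
    if "f \<in> \<Phi>" "c ` set ps \<subseteq> K" for f c
  proof -
    have "f (combine (map c ps) (map v ps)) = (\<Sum>i<length ps. f (c (ps ! i) \<otimes> v (ps ! i)))"
      using additive_combine[of f "map c ps" "map v ps"] add that KR vs by auto
    also have "\<dots> = (\<Sum>p\<in>set ps. f (c p \<otimes> v p))"
      by (rule sum.reindex_bij_betw[where g = "\<lambda>p. f (c p \<otimes> v p)"]) (rule bij_betw_nth[OF ps refl refl])
    finally show ?thesis .
  qed
  have "Span K (map v ps) = carrier R"
  proof
    show "Span K (map v ps) \<subseteq> carrier R"
      using Span_in_carrier[OF KR vs] .
    show "carrier R \<subseteq> Span K (map v ps)"
    proof
      fix x assume x: "x \<in> carrier R"
      obtain c where c: "c ` set ps \<subseteq> K" "\<And>f. f \<in> \<Phi> \<Longrightarrow> f x = (\<Sum>p\<in>set ps. f (c p \<otimes> v p))"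
        using span[OF x] by blast
      have "x = combine (map c ps) (map v ps)"
        using x c KR vs by (intro sep combine_in_carrier) (auto simp: comb)
      then show "x \<in> Span K (map v ps)"
        using c by (subst Span_mem_iff_length_version[OF K vs]) (auto intro!: exI[of _ "map c ps"])
    qed
  qed
  moreover have "independent K (map v ps)"
  proof (rule ccontr)
    assume "\<not> independent K (map v ps)"
    then obtain Ks where Ks: "length Ks = length (map v ps)" "combine Ks (map v ps) = \<zero>"
      "set Ks \<subseteq> K" "set Ks \<noteq> {\<zero>}" "map v ps \<noteq> []"
      using dependent_imp_non_trivial_combine[OF K vs] independent.li_Nil by metis
    \<comment> \<open>Distinctness of \<open>ps\<close> turns the coefficient list into a function
      of the index, the form in which \<open>indep\<close> is stated.\<close>
    define c where "c = the \<circ> map_of (zip ps Ks)"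
    have Ks_eq: "Ks = map c ps"
      by (rule nth_equalityI) (use Ks(1) ps in \<open>auto simp: c_def map_of_zip_nth\<close>)
    have c: "c ` set ps \<subseteq> K" using Ks(3) Ks_eq by auto
    have "f \<zero> = 0" if "f \<in> \<Phi>" for f
      using add[OF that, of \<zero> \<zero>] by simp
    then have "c p = \<zero>" if "p \<in> set ps" for p
      using indep[OF c _ that] comb[OF _ c] Ks(2) Ks_eq by auto
    then have "set Ks = {\<zero>}" using Ks(5) by (cases ps) (auto simp: Ks_eq)
    with Ks(4) show False by simp
  qed
  ultimately show ?thesis using vs by (simp add: k_basis_def)
qed

lemma Rats_approx:
  fixes r :: real
  shows "\<exists>q :: nat \<Rightarrow> complex. (\<forall>i. q i \<in> \<rat>) \<and> q \<longlonglongrightarrow> of_real r"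
proof -
  have "\<exists>q\<in>\<rat>. r < q \<and> q < r + inverse (real (Suc i))" for i
    by (rule Rats_dense_in_real) simp
  then obtain q where q: "\<And>i. q i \<in> \<rat>" "\<And>i. r < q i" "\<And>i. q i < r + inverse (real (Suc i))"
    by metis
  have "(\<lambda>i. r + inverse (real (Suc i))) \<longlonglongrightarrow> r + 0"
    by (intro tendsto_intros LIMSEQ_inverse_real_of_nat)
  then have lim: "(\<lambda>i. r + inverse (real (Suc i))) \<longlonglongrightarrow> r"
    by simp
  have "\<forall>i. r \<le> q i" "\<forall>i. q i \<le> r + inverse (real (Suc i))"
    using q(2,3) less_imp_le by blast+
  then have "q \<longlonglongrightarrow> r"
    by (intro tendsto_sandwich[OF _ _ tendsto_const lim] always_eventually)
  moreover have "complex_of_real (q i) \<in> \<rat>" for i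
    using q(1)[of i] by (auto elim!: Rats_cases')
  ultimately show ?thesis
    by (intro exI[of _ "\<lambda>i. of_real (q i)"]) (auto intro: tendsto_of_real)
qed

section \<open>Galois extensions\<close>

locale galois_extension =
  fixes L k :: "complex set"
  assumes galois: "finite_galois_extension L k"
begin

abbreviation G where "G \<equiv> galois_group L k"

lemma k_subfield: "subfield k CC" and L_subfield: "subfield L CC" and k_subset_L: "k \<subseteq> L"
  using galois by (auto simp: finite_galois_extension_def)

lemmas L_closed [simp] = subfield_CC[OF L_subfield]

lemma L_sum [simp]: "(\<And>i. i \<in> I \<Longrightarrow> f i \<in> L) \<Longrightarrow> sum f I \<in> L"
  by (rule subfield_CC_sum[OF L_subfield])

lemma k_in_L [simp]: "x \<in> k \<Longrightarrow> x \<in> L"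
  using k_subset_L by blast

lemma fixed_in_k: "x \<in> L \<Longrightarrow> (\<And>\<sigma>. \<sigma> \<in> carrier G \<Longrightarrow> \<sigma> x = x) \<Longrightarrow> x \<in> k"
  using galois unfolding finite_galois_extension_def by blast

lemma carrier_G:
  "\<sigma> \<in> carrier G \<longleftrightarrow> \<sigma> \<in> extensional L \<and> bij_betw \<sigma> L L \<and> \<sigma> 1 = 1 \<and>
     (\<forall>x\<in>L. \<forall>y\<in>L. \<sigma> (x + y) = \<sigma> x + \<sigma> y \<and> \<sigma> (x * y) = \<sigma> x * \<sigma> y) \<and> (\<forall>c\<in>k. \<sigma> c = c)"
  by (auto simp: galois_group_def field_auts_def ring_iso_def Ring.ring_hom_def bij_betw_def)

lemma gal_extensional: "\<sigma> \<in> carrier G \<Longrightarrow> \<sigma> \<in> extensional L"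
  and gal_bij: "\<sigma> \<in> carrier G \<Longrightarrow> bij_betw \<sigma> L L"
  and gal_one [simp]: "\<sigma> \<in> carrier G \<Longrightarrow> \<sigma> 1 = 1"
  and gal_add [simp]: "\<sigma> \<in> carrier G \<Longrightarrow> x \<in> L \<Longrightarrow> y \<in> L \<Longrightarrow> \<sigma> (x + y) = \<sigma> x + \<sigma> y"
  and gal_mult [simp]: "\<sigma> \<in> carrier G \<Longrightarrow> x \<in> L \<Longrightarrow> y \<in> L \<Longrightarrow> \<sigma> (x * y) = \<sigma> x * \<sigma> y"
  and gal_fix: "\<sigma> \<in> carrier G \<Longrightarrow> x \<in> k \<Longrightarrow> \<sigma> x = x"
  by (auto simp: carrier_G)

lemma gal_in_L [simp]: "\<sigma> \<in> carrier G \<Longrightarrow> x \<in> L \<Longrightarrow> \<sigma> x \<in> L"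
  using gal_bij bij_betwE by blast

lemma gal_inj: "\<sigma> \<in> carrier G \<Longrightarrow> x \<in> L \<Longrightarrow> y \<in> L \<Longrightarrow> \<sigma> x = \<sigma> y \<longleftrightarrow> x = y"
  using gal_bij by (metis bij_betw_imp_inj_on inj_on_eq_iff)

lemma gal_zero [simp]: "\<sigma> \<in> carrier G \<Longrightarrow> \<sigma> 0 = 0"
  using gal_add[of \<sigma> 0 0] by simp

lemma gal_eq_0_iff: "\<sigma> \<in> carrier G \<Longrightarrow> x \<in> L \<Longrightarrow> \<sigma> x = 0 \<longleftrightarrow> x = 0"
  using gal_inj[of \<sigma> x 0] by simp

lemma gal_sum:
  assumes "\<sigma> \<in> carrier G" "\<And>i. i \<in> I \<Longrightarrow> f i \<in> L"
  shows "\<sigma> (sum f I) = (\<Sum>i\<in>I. \<sigma> (f i))"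
  using assms(2) by (induction I rule: infinite_finite_induct) (simp_all add: assms(1))

lemma gal_eqI:
  assumes "\<sigma> \<in> carrier G" "\<rho> \<in> carrier G" "\<And>x. x \<in> L \<Longrightarrow> \<sigma> x = \<rho> x"
  shows "\<sigma> = \<rho>"
  using assms by (auto intro: extensionalityI gal_extensional)

lemma gal_in_Bij: "\<sigma> \<in> carrier G \<Longrightarrow> \<sigma> \<in> Bij L"
  by (simp add: Bij_def gal_bij gal_extensional)

lemma G_mult:
  assumes "\<sigma> \<in> carrier G" "\<rho> \<in> carrier G"
  shows "\<sigma> \<otimes>\<^bsub>G\<^esub> \<rho> = compose L \<sigma> \<rho>"
proof -
  have "\<sigma> \<otimes>\<^bsub>G\<^esub> \<rho> = \<sigma> \<otimes>\<^bsub>BijGroup L\<^esub> \<rho>"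
    by (simp add: galois_group_def)
  then show ?thesis
    using assms by (simp add: gal_in_Bij BijGroup_def)
qed

lemma G_one: "\<one>\<^bsub>G\<^esub> = (\<lambda>x\<in>L. x)"
  by (simp add: galois_group_def BijGroup_def)

lemma compose_in_G:
  assumes "\<sigma> \<in> carrier G" "\<rho> \<in> carrier G"
  shows "compose L \<sigma> \<rho> \<in> carrier G"
  using assms bij_betw_compose[OF gal_bij[OF assms(2)] gal_bij[OF assms(1)]]
  by (subst carrier_G) (auto simp: compose_def gal_fix)

lemma inverse_in_G:
  assumes "\<sigma> \<in> carrier G"
  shows "restrict (inv_into L \<sigma>) L \<in> carrier G"
    and "compose L (restrict (inv_into L \<sigma>) L) \<sigma> = (\<lambda>x\<in>L. x)"
proof -
  let ?\<tau> = "restrict (inv_into L \<sigma>) L"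
  note b = gal_bij[OF assms]
  have \<tau>\<sigma>: "?\<tau> (\<sigma> x) = x" if "x \<in> L" for x
    using that assms bij_betw_inv_into_left[OF b that] by simp
  have \<sigma>\<tau>: "\<sigma> (?\<tau> x) = x" and \<tau>L: "?\<tau> x \<in> L" if "x \<in> L" for x
    using that bij_betw_inv_into_right[OF b that] inv_into_into[of x \<sigma> L] b by (auto simp: bij_betw_def)
  have bij: "bij_betw ?\<tau> L L"
    using bij_betw_inv_into[OF b] by (rule bij_betw_cong[THEN iffD1, rotated]) simp
  have "?\<tau> (x + y) = ?\<tau> x + ?\<tau> y" "?\<tau> (x * y) = ?\<tau> x * ?\<tau> y" if "x \<in> L" "y \<in> L" for x y
    using \<tau>\<sigma>[of "?\<tau> x + ?\<tau> y"] \<tau>\<sigma>[of "?\<tau> x * ?\<tau> y"] that assms \<sigma>\<tau> \<tau>L by simp_all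
  moreover have "?\<tau> 1 = 1" "?\<tau> c = c" if "c \<in> k" for c
    using \<tau>\<sigma>[of 1] \<tau>\<sigma>[of c] assms that by (simp_all add: gal_fix)
  then have "?\<tau> 1 = 1" "\<forall>c\<in>k. ?\<tau> c = c"
    using subfield_CC(1)[OF k_subfield] by blast+
  ultimately show "?\<tau> \<in> carrier G"
    using bij by (subst carrier_G) (intro conjI ballI; simp)
  show "compose L ?\<tau> \<sigma> = (\<lambda>x\<in>L. x)"
    using \<tau>\<sigma> by (auto simp: compose_def intro!: restrict_ext)
qed

lemma one_in_G: "(\<lambda>x\<in>L. x) \<in> carrier G"
  by (subst carrier_G) (auto simp: bij_betw_def inj_on_def)

sublocale group G
proof (rule groupI)
  fix \<sigma> \<rho> \<pi> assume *: "\<sigma> \<in> carrier G" "\<rho> \<in> carrier G" "\<pi> \<in> carrier G"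
  then show "\<sigma> \<otimes>\<^bsub>G\<^esub> \<rho> \<in> carrier G"
    by (simp add: G_mult compose_in_G)
  show "\<sigma> \<otimes>\<^bsub>G\<^esub> \<rho> \<otimes>\<^bsub>G\<^esub> \<pi> = \<sigma> \<otimes>\<^bsub>G\<^esub> (\<rho> \<otimes>\<^bsub>G\<^esub> \<pi>)"
    using * by (intro gal_eqI) (simp_all add: G_mult compose_in_G, simp add: compose_def)
next
  fix \<sigma> assume *: "\<sigma> \<in> carrier G"
  show "\<exists>\<rho>\<in>carrier G. \<rho> \<otimes>\<^bsub>G\<^esub> \<sigma> = \<one>\<^bsub>G\<^esub>"
    using * inverse_in_G[OF *]
    by (intro bexI[of _ "restrict (inv_into L \<sigma>) L"]) (simp_all add: G_mult G_one)
  show "\<one>\<^bsub>G\<^esub> \<otimes>\<^bsub>G\<^esub> \<sigma> = \<sigma>"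
    using * one_in_G by (intro gal_eqI) (simp_all add: G_one G_mult compose_in_G, simp add: compose_def)
qed (simp add: G_one one_in_G)

lemma gal_mult_apply [simp]:
  "\<sigma> \<in> carrier G \<Longrightarrow> \<rho> \<in> carrier G \<Longrightarrow> x \<in> L \<Longrightarrow> (\<sigma> \<otimes>\<^bsub>G\<^esub> \<rho>) x = \<sigma> (\<rho> x)"
  by (simp add: G_mult compose_def)

lemma gal_one_apply [simp]: "x \<in> L \<Longrightarrow> \<one>\<^bsub>G\<^esub> x = x"
  by (simp add: G_one)

lemma gal_inv_apply [simp]:
  assumes "\<sigma> \<in> carrier G" "x \<in> L"
  shows "(inv\<^bsub>G\<^esub> \<sigma>) (\<sigma> x) = x" "\<sigma> ((inv\<^bsub>G\<^esub> \<sigma>) x) = x"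
  using assms gal_mult_apply[of "inv\<^bsub>G\<^esub> \<sigma>" \<sigma> x] gal_mult_apply[of \<sigma> "inv\<^bsub>G\<^esub> \<sigma>" x] by simp_all

definition trace :: "complex \<Rightarrow> complex" where
  "trace x = (\<Sum>\<sigma>\<in>carrier G. \<sigma> x)"

text \<open>Left translation by \<open>\<rho>\<close> permutes the summands, and the fixed field of
  \<open>G\<close> is \<open>k\<close>.\<close>

lemma trace_in_k:
  assumes "x \<in> L"
  shows "trace x \<in> k"
proof (rule fixed_in_k)
  show "trace x \<in> L" using assms by (simp add: trace_def)
  fix \<rho> assume \<rho>: "\<rho> \<in> carrier G"
  have "\<rho> (trace x) = (\<Sum>\<sigma>\<in>carrier G. (\<rho> \<otimes>\<^bsub>G\<^esub> \<sigma>) x)"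
    using assms \<rho> by (simp add: trace_def gal_sum)
  also have "\<dots> = trace x"
    unfolding trace_def
    by (rule sum.reindex_bij_betw[where g = "\<lambda>\<sigma>. \<sigma> x"])
       (use \<rho> in \<open>simp add: bij_betw_def inj_on_cmult surj_const_mult\<close>)
  finally show "\<rho> (trace x) = trace x" .
qed

lemma trace_one: "trace 1 = of_nat (card (carrier G))"
  by (simp add: trace_def)

end

section \<open>Evaluations of a \<open>k\<close>-basis of \<open>L\<close> at the
  automorphisms\<close>

locale galois_extension_basis = galois_extension +
  fixes m :: nat and b :: "nat \<Rightarrow> complex"
  assumes b_in_L: "\<And>i. i < m \<Longrightarrow> b i \<in> L"
    and b_span: "\<And>x. x \<in> L \<Longrightarrow> \<exists>c. (\<forall>i. c i \<in> k) \<and> x = (\<Sum>i<m. c i * b i)"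
    and b_indep: "\<And>c i. (\<And>i. c i \<in> k) \<Longrightarrow> (\<Sum>i<m. c i * b i) = 0 \<Longrightarrow> i < m \<Longrightarrow> c i = 0"

lemma (in galois_extension) basis_exists: "\<exists>m b. galois_extension_basis L k m b"
proof -
  interpret CC: ring CC by (rule ring_CC)
  obtain m Us where Us: "CC.independent k Us" "length Us = m" "CC.Span k Us = L"
    using galois CC.exists_base unfolding finite_galois_extension_def CC.finite_dimension_def by metis
  note vs = CC.independent_in_carrier[OF Us(1)]
  have comb: "CC.combine Ks Us = (\<Sum>i<m. Ks ! i * Us ! i)" if "length Ks = m" for Ks
    using CC.additive_combine[of id Ks Us] that Us(2) by simp
  have "galois_extension_basis L k m ((!) Us)"
  proof unfold_locales
    show "Us ! i \<in> L" if "i < m" for i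
      using CC.Span_base_incl[OF k_subfield vs] Us that by auto
    show "\<exists>c. (\<forall>i. c i \<in> k) \<and> x = (\<Sum>i<m. c i * Us ! i)" if "x \<in> L" for x
    proof -
      have "\<exists>Ks. set Ks \<subseteq> k \<and> length Ks = length Us \<and> x = CC.combine Ks Us"
        using that Us(3) CC.Span_mem_iff_length_version[OF k_subfield vs] by blast
      then obtain Ks where "set Ks \<subseteq> k" "length Ks = m" "x = (\<Sum>i<m. Ks ! i * Us ! i)"
        using comb Us(2) by auto
      then show ?thesis
        using subfield_CC(1)[OF k_subfield]
        by (intro exI[of _ "\<lambda>i. if i < m then Ks ! i else 0"]) (auto dest!: nth_mem)
    qed
    show "c i = 0" if "\<And>i. c i \<in> k" "(\<Sum>i<m. c i * Us ! i) = 0" "i < m" for c i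
    proof -
      have "CC.combine (map c [0..<m]) Us = 0"
        using that by (simp add: comb)
      then have "set (take (length Us) (map c [0..<m])) \<subseteq> {0}"
        using CC.independent_imp_trivial_combine[OF k_subfield Us(1), of "map c [0..<m]"] that(1) by auto
      then show ?thesis using that(3) Us(2) by (auto simp: image_subset_iff)
    qed
  qed
  then show ?thesis by blast
qed

context galois_extension_basis
begin

text \<open>
  The functions \<open>\<sigma> \<mapsto> \<Sum>\<^sub>i c\<^sub>i \<sigma> b\<^sub>i\<close> form the algebra spanned by the evaluations \<open>\<sigma> \<mapsto> \<sigma> x\<close>, which
  separate the points of \<open>G\<close>.
\<close>

lemma evaluations_span:
  assumes "finite S" "S \<subseteq> carrier G"
  shows "\<exists>c. \<forall>\<sigma>\<in>S. v \<sigma> = (\<Sum>i<m. c i * \<sigma> (b i))"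
proof -
  define A where "A = {f. \<exists>c. \<forall>\<sigma>\<in>carrier G. f \<sigma> = (\<Sum>i<m. c i * \<sigma> (b i))}"
  have AI: "f \<in> A" if "\<forall>\<sigma>\<in>carrier G. f \<sigma> = (\<Sum>i<m. c i * \<sigma> (b i))" for f c
    using that by (auto simp: A_def)
  have ev: "(\<lambda>\<sigma>. \<sigma> x) \<in> A" if x: "x \<in> L" for x
  proof -
    obtain c where c: "\<And>i. c i \<in> k" "x = (\<Sum>i<m. c i * b i)"
      using b_span[OF x] by blast
    have "\<forall>\<sigma>\<in>carrier G. \<sigma> x = (\<Sum>i<m. c i * \<sigma> (b i))"
      unfolding c(2)
    proof
      fix \<sigma> assume \<sigma>: "\<sigma> \<in> carrier G"
      show "\<sigma> (\<Sum>i<m. c i * b i) = (\<Sum>i<m. c i * \<sigma> (b i))"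
        by (subst gal_sum[OF \<sigma>]) (simp_all add: \<sigma> c(1) b_in_L gal_fix[OF \<sigma> c(1)])
    qed
    then show ?thesis by (intro AI)
  qed
  have add: "(\<lambda>\<sigma>. f \<sigma> + g \<sigma>) \<in> A" if fg: "f \<in> A" "g \<in> A" for f g
  proof -
    obtain c d where "\<forall>\<sigma>\<in>carrier G. f \<sigma> = (\<Sum>i<m. c i * \<sigma> (b i))"
      "\<forall>\<sigma>\<in>carrier G. g \<sigma> = (\<Sum>i<m. d i * \<sigma> (b i))"
      using fg unfolding A_def by blast
    then have "\<forall>\<sigma>\<in>carrier G. f \<sigma> + g \<sigma> = (\<Sum>i<m. (c i + d i) * \<sigma> (b i))"
      by (simp add: distrib_right sum.distrib)
    then show ?thesis by (intro AI)
  qed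
  have scale: "(\<lambda>\<sigma>. z * f \<sigma>) \<in> A" if f: "f \<in> A" for z f
  proof -
    obtain c where "\<forall>\<sigma>\<in>carrier G. f \<sigma> = (\<Sum>i<m. c i * \<sigma> (b i))"
      using f unfolding A_def by blast
    then have "\<forall>\<sigma>\<in>carrier G. z * f \<sigma> = (\<Sum>i<m. (z * c i) * \<sigma> (b i))"
      by (simp add: sum_distrib_left mult.assoc)
    then show ?thesis by (intro AI)
  qed
  have const: "(\<lambda>_. z) \<in> A" for z
  proof -
    obtain c where "\<forall>\<sigma>\<in>carrier G. z * \<sigma> 1 = (\<Sum>i<m. c i * \<sigma> (b i))"
      using scale[OF ev[of 1], of z] unfolding A_def by auto
    then have "\<forall>\<sigma>\<in>carrier G. z = (\<Sum>i<m. c i * \<sigma> (b i))" by simp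
    then show ?thesis by (intro AI)
  qed
  have sumA: "(\<lambda>\<sigma>. \<Sum>i\<in>I. h i \<sigma>) \<in> A" if "\<And>i. i \<in> I \<Longrightarrow> h i \<in> A" for I :: "nat set" and h
    using that by (induction I rule: infinite_finite_induct) (auto simp: const intro: add)
  have mult: "(\<lambda>\<sigma>. f \<sigma> * g \<sigma>) \<in> A" if fg: "f \<in> A" "g \<in> A" for f g
  proof -
    obtain c d where cd: "\<forall>\<sigma>\<in>carrier G. f \<sigma> = (\<Sum>i<m. c i * \<sigma> (b i))"
      "\<forall>\<sigma>\<in>carrier G. g \<sigma> = (\<Sum>i<m. d i * \<sigma> (b i))"
      using fg unfolding A_def by blast
    \<comment> \<open>Products of basis elements lie in \<open>L\<close>, so their evaluations are
      back in the span. Automorphisms being multiplicative is what makes the span an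
      algebra.\<close>
    have "(\<lambda>\<sigma>. \<Sum>i<m. \<Sum>j<m. (c i * d j) * \<sigma> (b i * b j)) \<in> A"
      by (intro sumA scale ev) (simp add: b_in_L)
    then obtain e where e: "\<forall>\<sigma>\<in>carrier G.
        (\<Sum>i<m. \<Sum>j<m. (c i * d j) * \<sigma> (b i * b j)) = (\<Sum>i<m. e i * \<sigma> (b i))"
      unfolding A_def by blast
    have "\<forall>\<sigma>\<in>carrier G. f \<sigma> * g \<sigma> = (\<Sum>i<m. e i * \<sigma> (b i))"
    proof
      fix \<sigma> assume that: "\<sigma> \<in> carrier G"
      have "f \<sigma> * g \<sigma> = (\<Sum>i<m. \<Sum>j<m. (c i * d j) * \<sigma> (b i * b j))"
        using that cd by (simp add: sum_product b_in_L mult_ac)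
      then show "f \<sigma> * g \<sigma> = (\<Sum>i<m. e i * \<sigma> (b i))"
        using e that by simp
    qed
    then show ?thesis by (intro AI)
  qed
  have "\<exists>f\<in>A. \<forall>s\<in>S. f s = v s"
  proof (rule separating_algebra_interpolates[OF assms(1) const add mult])
    fix s t assume st: "s \<in> S" "t \<in> S" "s \<noteq> t"
    then obtain x where "x \<in> L" "s x \<noteq> t x"
      using gal_eqI[of s t] assms(2) by blast
    then show "\<exists>f\<in>A. f s \<noteq> f t"
      using ev[of x] by (intro bexI[of _ "\<lambda>\<sigma>. \<sigma> x"])
  qed
  then show ?thesis
    using assms(2) unfolding A_def by fastforce
qed

text \<open>Independence of distinct automorphisms. A relation \<open>d\<close> among the vectors
  \<open>\<sigma> (b i)\<close>, indexed by \<open>i < m\<close>, for \<open>\<sigma>\<close> in a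
  finite set \<open>S\<close> annihilates every combination of evaluations. Indicators of points of
  \<open>S\<close> are such combinations, so \<open>d\<close> vanishes and \<open>S\<close> has at
  most \<open>m\<close> elements.\<close>

lemma finite_G: "finite (carrier G)"
proof -
  have "card S \<le> m" if S: "S \<subseteq> carrier G" "finite S" for S
  proof (rule ccontr)
    assume "\<not> card S \<le> m"
    then obtain d where d: "\<exists>\<sigma>\<in>S. d \<sigma> \<noteq> 0" "\<forall>i<m. (\<Sum>\<sigma>\<in>S. d \<sigma> * \<sigma> (b i)) = 0"
      using linear_relation_exists[OF S(2), of m "\<lambda>\<sigma> i. \<sigma> (b i)"] by auto
    then obtain \<rho> where \<rho>: "\<rho> \<in> S" "d \<rho> \<noteq> 0" by blast
    obtain c where c: "\<forall>\<sigma>\<in>S. (if \<sigma> = \<rho> then 1 else 0) = (\<Sum>i<m. c i * \<sigma> (b i))"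
      using evaluations_span[OF S(2,1), of "\<lambda>\<sigma>. if \<sigma> = \<rho> then 1 else 0"] by blast
    have "d \<rho> = (\<Sum>\<sigma>\<in>S. d \<sigma> * (if \<sigma> = \<rho> then 1 else 0))"
      using S \<rho> by (simp add: if_distrib cong: if_cong)
    also have "\<dots> = (\<Sum>\<sigma>\<in>S. \<Sum>i<m. c i * (d \<sigma> * \<sigma> (b i)))"
      using c by (intro sum.cong) (simp_all add: sum_distrib_left mult_ac)
    also have "\<dots> = (\<Sum>i<m. c i * (\<Sum>\<sigma>\<in>S. d \<sigma> * \<sigma> (b i)))"
      by (subst sum.swap) (simp add: sum_distrib_left)
    also have "\<dots> = 0" using d(2) by simp
    finally show False using \<rho> by simp
  qed
  then show ?thesis
    using finite_if_finite_subsets_card_bdd[of "carrier G" m] by blast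
qed

lemma card_G_pos: "card (carrier G) > 0"
  using finite_G by (simp add: card_gt_0_iff) (metis empty_iff one_closed)

text \<open>Since \<open>trace (x * inverse x) \<noteq> 0\<close>, the trace form of \<open>L\<close> over \<open>k\<close> is nondegenerate.\<close>

lemma evaluations_independent:
  assumes "\<And>\<sigma>. \<sigma> \<in> carrier G \<Longrightarrow> (\<Sum>i<m. c i * \<sigma> (b i)) = 0" "i < m"
  shows "c i = 0"
proof (rule ccontr)
  assume "c i \<noteq> 0"
  \<comment> \<open>The coefficients \<open>c\<close> are complex, whereas \<open>b\<close> is
    independent over \<open>k\<close> only. The functions \<open>x \<mapsto> trace (b i * x)\<close>
    satisfy the same relation and take values in \<open>k\<close>, so the relation can be moved down
    to \<open>k\<close>.\<close>
  define f where "f i x = trace (b i * x)" for i x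
  have "(\<Sum>i<m. c i * f i x) = 0" if "x \<in> L" for x
  proof -
    have "(\<Sum>i<m. c i * f i x) = (\<Sum>i<m. \<Sum>\<sigma>\<in>carrier G. \<sigma> x * (c i * \<sigma> (b i)))"
      using that b_in_L by (simp add: f_def trace_def sum_distrib_left mult_ac)
    also have "\<dots> = (\<Sum>\<sigma>\<in>carrier G. \<sigma> x * (\<Sum>i<m. c i * \<sigma> (b i)))"
      by (subst sum.swap) (simp add: sum_distrib_left)
    finally show ?thesis using assms(1) by simp
  qed
  moreover have "f i x \<in> k" if "i < m" "x \<in> L" for i x
    using that b_in_L by (simp add: f_def trace_in_k)
  ultimately obtain d where d: "\<And>i. d i \<in> k" "\<exists>i<m. d i \<noteq> 0" "\<And>x. x \<in> L \<Longrightarrow> (\<Sum>i<m. d i * f i x) = 0"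
    using linear_relation_descends[OF k_subfield, of m L f c] assms(2) \<open>c i \<noteq> 0\<close> by blast
  \<comment> \<open>\<open>y\<close> is orthogonal to all of \<open>L\<close> under the trace form;
    pairing it with \<open>inverse y\<close> gives the order of \<open>G\<close> instead of
    0.\<close>
  define y where "y = (\<Sum>i<m. d i * b i)"
  have y: "y \<in> L" "y \<noteq> 0"
  proof -
    show "y \<in> L"
      unfolding y_def by (intro L_sum L_closed k_in_L d(1) b_in_L) simp
    show "y \<noteq> 0"
    proof
      assume "y = 0"
      then have "\<forall>i<m. d i = 0"
        unfolding y_def by (intro allI impI b_indep[of d, OF d(1)])
      with d(2) show False by blast
    qed
  qed
  have "trace (y * inverse y) = (\<Sum>\<sigma>\<in>carrier G. \<Sum>i<m. d i * (\<sigma> (b i) * \<sigma> (inverse y)))"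
    unfolding trace_def
  proof (rule sum.cong[OF refl])
    fix \<sigma> assume \<sigma>: "\<sigma> \<in> carrier G"
    have "\<sigma> y = (\<Sum>i<m. d i * \<sigma> (b i))"
      unfolding y_def by (subst gal_sum[OF \<sigma>]) (simp_all add: \<sigma> d(1) b_in_L gal_fix[OF \<sigma> d(1)])
    then show "\<sigma> (y * inverse y) = (\<Sum>i<m. d i * (\<sigma> (b i) * \<sigma> (inverse y)))"
      using \<sigma> y(1) by (simp add: sum_distrib_right mult.assoc del: right_inverse)
  qed
  also have "\<dots> = (\<Sum>i<m. d i * f i (inverse y))"
    using b_in_L y by (subst sum.swap) (simp add: f_def trace_def sum_distrib_left)
  also have "\<dots> = 0"
    using d(3)[of "inverse y"] y by simp
  finally show False
    using y card_G_pos by (simp add: trace_one)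
qed

end

section \<open>Matrix algebras\<close>

definition scalar_mats :: "nat \<Rightarrow> complex mat set" where
  "scalar_mats N = range (\<lambda>c. c \<cdot>\<^sub>m 1\<^sub>m N)"

abbreviation MM :: "nat \<Rightarrow> complex mat ring" where
  "MM N \<equiv> ring_mat TYPE(complex) N ()"

lemma scalar_mat_mult:
  fixes A :: "complex mat"
  assumes "A \<in> carrier_mat N N"
  shows "(c \<cdot>\<^sub>m 1\<^sub>m N) * A = c \<cdot>\<^sub>m A"
  using assms by (subst mult_smult_assoc_mat[of _ N N _ N]) auto

text \<open>The copy of the complex numbers over which \<open>splitting\<close> takes bases. For
  \<open>N = 0\<close> the matrix ring is zero and contains no subfield, so degree 0 has to be
  excluded separately later on.\<close>

lemma scalar_mats_subfield:
  assumes "N > 0"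
  shows "subfield (scalar_mats N) (MM N)"
proof -
  have "(\<lambda>c. c \<cdot>\<^sub>m 1\<^sub>m N) \<in> Ring.ring_hom CC (MM N)"
    by (rule Ring.ring_hom_memI) (auto simp: ring_mat_simps add_smult_distrib_right_mat scalar_mat_mult)
  then interpret ring_hom_ring CC "MM N" "\<lambda>c. c \<cdot>\<^sub>m 1\<^sub>m N"
    by (intro ring_hom_ringI2 ring_CC ring_mat)
  have "(1\<^sub>m N :: complex mat) $$ (0, 0) \<noteq> 0\<^sub>m N N $$ (0, 0)"
    using assms by simp
  then have "\<one>\<^bsub>MM N\<^esub> \<noteq> \<zero>\<^bsub>MM N\<^esub>"
    by (metis ring_mat_simps(3,4))
  have CC: "field CC"
    by (rule field_from_type_algebra)
  from img_is_subfield(2)[OF _ \<open>\<one>\<^bsub>MM N\<^esub> \<noteq> \<zero>\<^bsub>MM N\<^esub>\<close>, of UNIV] show ?thesis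
    using field.carrier_is_subfield[OF CC] by (simp add: scalar_mats_def)
qed

text \<open>Matrix entries act as the separating coordinates, and scalar matrices are replaced by
  complex coefficients.\<close>

lemma k_basis_mat_mapI:
  assumes "N > 0" and ps: "distinct ps" and v: "\<And>p. p \<in> set ps \<Longrightarrow> v p \<in> carrier_mat N N"
    and span: "\<And>A. A \<in> carrier_mat N N \<Longrightarrow>
      \<exists>d. \<forall>i<N. \<forall>j<N. A $$ (i, j) = (\<Sum>p\<in>set ps. d p * v p $$ (i, j))"
    and indep: "\<And>d p. (\<And>i j. i < N \<Longrightarrow> j < N \<Longrightarrow> (\<Sum>p\<in>set ps. d p * v p $$ (i, j)) = 0) \<Longrightarrow>
      p \<in> set ps \<Longrightarrow> d p = 0"
  shows "k_basis (MM N) (scalar_mats N) (map v ps)"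
proof (rule k_basis_mapI[where \<Phi> = "{\<lambda>A. A $$ (i, j) | i j. i < N \<and> j < N}"])
  let ?\<Phi> = "{\<lambda>A :: complex mat. A $$ (i, j) | i j. i < N \<and> j < N}"
  have scal: "f ((d \<cdot>\<^sub>m 1\<^sub>m N) \<otimes>\<^bsub>MM N\<^esub> v p) = d * f (v p)" if "f \<in> ?\<Phi>" "p \<in> set ps" for f d p
    using that v[OF that(2)] by (auto simp: ring_mat_simps scalar_mat_mult)
  show "ring (MM N)" by (rule ring_mat)
  show "subfield (scalar_mats N) (MM N)" using \<open>N > 0\<close> by (rule scalar_mats_subfield)
  show "distinct ps" by fact
  show "v p \<in> carrier (MM N)" if "p \<in> set ps" for p
    using v that by (simp add: ring_mat_simps)
  show "f (x \<oplus>\<^bsub>MM N\<^esub> y) = f x + f y" if "f \<in> ?\<Phi>" "x \<in> carrier (MM N)" "y \<in> carrier (MM N)" for f x y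
    using that by (auto simp: ring_mat_simps)
  show "x = y" if "x \<in> carrier (MM N)" "y \<in> carrier (MM N)" "\<And>f. f \<in> ?\<Phi> \<Longrightarrow> f x = f y" for x y
  proof (rule eq_matI)
    fix i j assume ij: "i < dim_row y" "j < dim_col y"
    then have "(\<lambda>A :: complex mat. A $$ (i, j)) \<in> ?\<Phi>"
      using that(2) by (auto simp: ring_mat_simps)
    from that(3)[OF this] show "x $$ (i, j) = y $$ (i, j)" .
  qed (use that(1,2) in \<open>auto simp: ring_mat_simps\<close>)
  show "\<exists>c. c ` set ps \<subseteq> scalar_mats N \<and> (\<forall>f\<in>?\<Phi>. f x = (\<Sum>p\<in>set ps. f (c p \<otimes>\<^bsub>MM N\<^esub> v p)))"
    if x: "x \<in> carrier (MM N)" for x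
  proof -
    obtain d where d: "\<forall>i<N. \<forall>j<N. x $$ (i, j) = (\<Sum>p\<in>set ps. d p * v p $$ (i, j))"
      using span[of x] x by (auto simp: ring_mat_simps)
    have "f x = (\<Sum>p\<in>set ps. f ((d p \<cdot>\<^sub>m 1\<^sub>m N) \<otimes>\<^bsub>MM N\<^esub> v p))" if "f \<in> ?\<Phi>" for f
    proof -
      have "f x = (\<Sum>p\<in>set ps. d p * f (v p))" using d that by auto
      then show ?thesis by (simp add: scal[OF that])
    qed
    then show ?thesis
      by (intro exI[of _ "\<lambda>p. d p \<cdot>\<^sub>m 1\<^sub>m N"]) (auto simp: scalar_mats_def)
  qed
  show "c p = \<zero>\<^bsub>MM N\<^esub>"
    if c: "c ` set ps \<subseteq> scalar_mats N" and rel: "\<And>f. f \<in> ?\<Phi> \<Longrightarrow> (\<Sum>p\<in>set ps. f (c p \<otimes>\<^bsub>MM N\<^esub> v p)) = 0"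
      and p: "p \<in> set ps" for c p
  proof -
    have "\<forall>p\<in>set ps. \<exists>d. c p = d \<cdot>\<^sub>m 1\<^sub>m N"
      using c by (auto simp: scalar_mats_def)
    then obtain d where d: "\<And>p. p \<in> set ps \<Longrightarrow> c p = d p \<cdot>\<^sub>m 1\<^sub>m N" by metis
    have "(\<Sum>p\<in>set ps. d p * v p $$ (i, j)) = 0" if "i < N" "j < N" for i j
    proof -
      have *: "(\<lambda>A :: complex mat. A $$ (i, j)) \<in> ?\<Phi>" using that by auto
      show ?thesis using rel[OF *] scal[OF *] d by simp
    qed
    then have "d p = 0" using indep p by blast
    then show ?thesis using d[OF p] by (auto simp: ring_mat_simps)
  qed
qed

text \<open>Counts the matrix units. Compared with the length of another basis, this recovers the
  size of a splitting from the dimension of \<open>B\<close>.\<close>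

lemma dimension_mat:
  assumes "N > 0"
  shows "ring.dimension (MM N) (N * N) (scalar_mats N) (carrier (MM N))"
proof -
  interpret ring "MM N" by (rule ring_mat)
  define ps where "ps = List.product [0..<N] [0..<N]"
  define v :: "nat \<times> nat \<Rightarrow> complex mat"
    where "v p = mat N N (\<lambda>q. if q = p then 1 else 0)" for p
  have ps: "distinct ps" "set ps = {..<N} \<times> {..<N}" "length ps = N * N"
    by (auto simp: ps_def distinct_product)
  have sum: "(\<Sum>p\<in>set ps. d p * v p $$ (i, j)) = d (i, j)" if "i < N" "j < N" for d i j
  proof -
    have "(\<Sum>p\<in>set ps. d p * v p $$ (i, j)) = (\<Sum>p\<in>set ps. if (i, j) = p then d p else 0)"
      using that by (intro sum.cong) (auto simp: v_def)
    also have "\<dots> = d (i, j)"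
      using that by (subst sum.delta') (auto simp: ps)
    finally show ?thesis .
  qed
  have "k_basis (MM N) (scalar_mats N) (map v ps)"
  proof (rule k_basis_mat_mapI[OF assms ps(1)])
    show "\<exists>d. \<forall>i<N. \<forall>j<N. A $$ (i, j) = (\<Sum>p\<in>set ps. d p * v p $$ (i, j))" for A
      by (intro exI[of _ "\<lambda>p. A $$ p"]) (simp add: sum)
    show "d p = 0" if "\<And>i j. i < N \<Longrightarrow> j < N \<Longrightarrow> (\<Sum>p\<in>set ps. d p * v p $$ (i, j)) = 0"
      "p \<in> set ps" for d p
      using that sum[of "fst p" "snd p" d] by (auto simp: ps)
  qed (simp add: v_def)
  then show ?thesis
    using dimensionI[of "scalar_mats N" "map v ps"] ps(3) by (simp add: k_basis_def scalar_mats_subfield[OF assms])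
qed

lemma (in ring) independent_trivial_ring:
  "independent K Us \<Longrightarrow> carrier R = {\<zero>} \<Longrightarrow> Us = []"
  by (induction rule: independent.induct) auto

lemma mat_trace_comm:
  fixes A B :: "complex mat"
  assumes "A \<in> carrier_mat N N" "B \<in> carrier_mat N N"
  shows "(\<Sum>i<N. (A * B) $$ (i, i)) = (\<Sum>i<N. (B * A) $$ (i, i))"
proof -
  have "(\<Sum>i<N. (A * B) $$ (i, i)) = (\<Sum>i<N. \<Sum>j<N. A $$ (i, j) * B $$ (j, i))"
    using assms by (intro sum.cong) (auto simp: scalar_prod_def lessThan_atLeast0)
  also have "\<dots> = (\<Sum>j<N. \<Sum>i<N. B $$ (j, i) * A $$ (i, j))"
    by (subst sum.swap) (simp add: mult.commute)
  also have "\<dots> = (\<Sum>i<N. (B * A) $$ (i, i))"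
    using assms by (intro sum.cong) (auto simp: scalar_prod_def lessThan_atLeast0)
  finally show ?thesis .
qed

section \<open>The reduced trace of a crossed product\<close>

locale crossed_product_algebra = galois_extension_basis +
  fixes \<xi> :: "(complex \<Rightarrow> complex) \<Rightarrow> (complex \<Rightarrow> complex) \<Rightarrow> complex"
  assumes two_cocycle: "two_cocycle L k \<xi>"
    and skew: "skew_field (crossed_product \<xi> L k)"
begin

abbreviation B where "B \<equiv> crossed_product \<xi> L k"
abbreviation \<iota> where "\<iota> \<equiv> cp_embed \<xi> L k"
abbreviation mon where "mon \<equiv> cp_monom L k"

lemma xi_in_L [simp]: "\<sigma> \<in> carrier G \<Longrightarrow> \<rho> \<in> carrier G \<Longrightarrow> \<xi> \<sigma> \<rho> \<in> L"
  and xi_nonzero [simp]: "\<sigma> \<in> carrier G \<Longrightarrow> \<rho> \<in> carrier G \<Longrightarrow> \<xi> \<sigma> \<rho> \<noteq> 0"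
  and cocycle: "\<sigma> \<in> carrier G \<Longrightarrow> \<rho> \<in> carrier G \<Longrightarrow> \<pi> \<in> carrier G \<Longrightarrow>
    \<xi> \<sigma> \<rho> * \<xi> (\<sigma> \<otimes>\<^bsub>G\<^esub> \<rho>) \<pi> = \<sigma> (\<xi> \<rho> \<pi>) * \<xi> \<sigma> (\<rho> \<otimes>\<^bsub>G\<^esub> \<pi>)"
  using two_cocycle by (auto simp: two_cocycle_def Let_def)

text \<open>Substitutes for normalization of the cocycle. This lemma and the next say exactly how
  the denominator in \<open>cp_embed\<close> cancels when \<open>\<iota> c\<close> is multiplied
  with a monomial from either side.\<close>

lemma xi_one_left: 
  assumes "\<sigma> \<in> carrier G" shows "\<xi> \<one>\<^bsub>G\<^esub> \<sigma> = \<xi> \<one>\<^bsub>G\<^esub> \<one>\<^bsub>G\<^esub>"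
  using cocycle[of "\<one>\<^bsub>G\<^esub>" "\<one>\<^bsub>G\<^esub>" \<sigma>] assms by simp

lemma xi_one_right:
  assumes "\<sigma> \<in> carrier G" shows "\<xi> \<sigma> \<one>\<^bsub>G\<^esub> = \<sigma> (\<xi> \<one>\<^bsub>G\<^esub> \<one>\<^bsub>G\<^esub>)"
  using cocycle[of \<sigma> "\<one>\<^bsub>G\<^esub>" "\<one>\<^bsub>G\<^esub>"] assms by simp

lemma carrier_B: "carrier B = carrier G \<rightarrow>\<^sub>E L"
  and zero_B: "\<zero>\<^bsub>B\<^esub> = (\<lambda>\<pi>\<in>carrier G. 0)"
  and one_B: "\<one>\<^bsub>B\<^esub> = \<iota> 1"
  and add_B: "x \<oplus>\<^bsub>B\<^esub> y = (\<lambda>\<pi>\<in>carrier G. x \<pi> + y \<pi>)"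
  by (simp_all add: crossed_product_def Let_def)

lemma B_apply: "x \<in> carrier B \<Longrightarrow> \<sigma> \<in> carrier G \<Longrightarrow> x \<sigma> \<in> L"
  by (auto simp: carrier_B)

lemma ring_B: "ring B"
  using skew by (simp add: skew_field_def)

lemma B_eqI: "x \<in> carrier B \<Longrightarrow> y \<in> carrier B \<Longrightarrow> (\<And>\<pi>. \<pi> \<in> carrier G \<Longrightarrow> x \<pi> = y \<pi>) \<Longrightarrow> x = y"
  by (auto simp: carrier_B intro: PiE_ext)

lemma mon_apply: "\<pi> \<in> carrier G \<Longrightarrow> mon c \<sigma> \<pi> = (if \<pi> = \<sigma> then c else 0)"
  by (simp add: cp_monom_def)

lemma mon_in_B: "c \<in> L \<Longrightarrow> mon c \<sigma> \<in> carrier B"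
  by (auto simp: carrier_B cp_monom_def)

lemma mon_mult:
  "\<sigma> \<in> carrier G \<Longrightarrow> \<rho> \<in> carrier G \<Longrightarrow>
    mon a \<sigma> \<otimes>\<^bsub>B\<^esub> mon c \<rho> = mon (a * \<sigma> c * \<xi> \<sigma> \<rho>) (\<sigma> \<otimes>\<^bsub>G\<^esub> \<rho>)"
  by (rule cp_monom_mult) (simp_all add: finite_G)

lemma embed_eq: "\<iota> c = mon (c / \<xi> \<one>\<^bsub>G\<^esub> \<one>\<^bsub>G\<^esub>) \<one>\<^bsub>G\<^esub>"
  by (simp add: cp_embed_def Let_def)

lemma embed_in_B: "c \<in> L \<Longrightarrow> \<iota> c \<in> carrier B"
  by (simp add: embed_eq mon_in_B)

lemma embed_zero: "\<iota> 0 = \<zero>\<^bsub>B\<^esub>"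
  by (auto simp: embed_eq zero_B cp_monom_def)

lemma embed_mult_mon:
  "c \<in> L \<Longrightarrow> a \<in> L \<Longrightarrow> \<sigma> \<in> carrier G \<Longrightarrow> \<iota> c \<otimes>\<^bsub>B\<^esub> mon a \<sigma> = mon (c * a) \<sigma>"
  by (simp add: embed_eq mon_mult xi_one_left[of \<sigma>])

lemma embed_mult: "c \<in> L \<Longrightarrow> d \<in> L \<Longrightarrow> \<iota> (c * d) = \<iota> c \<otimes>\<^bsub>B\<^esub> \<iota> d"
  by (simp add: embed_eq[of d] embed_mult_mon) (simp add: embed_eq)

lemma embed_add: "\<iota> (c + d) = \<iota> c \<oplus>\<^bsub>B\<^esub> \<iota> d"
  by (auto simp: embed_eq add_B cp_monom_def add_divide_distrib)

lemma embed_eq_zero_iff: "\<iota> c = \<zero>\<^bsub>B\<^esub> \<longleftrightarrow> c = 0"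
proof
  assume "\<iota> c = \<zero>\<^bsub>B\<^esub>"
  then have "\<iota> c \<one>\<^bsub>G\<^esub> = \<zero>\<^bsub>B\<^esub> \<one>\<^bsub>G\<^esub>" by simp
  then show "c = 0" by (simp add: embed_eq mon_apply zero_B)
qed (simp add: embed_zero)

lemma embed_hom: "\<iota> \<in> Ring.ring_hom (CC\<lparr>carrier := k\<rparr>) B"
  by (rule Ring.ring_hom_memI) (auto simp: embed_in_B embed_mult embed_add one_B)

lemma embed_k_subfield: "subfield (\<iota> ` k) B"
proof -
  interpret CC: ring CC by (rule ring_CC)
  have field: "field (CC\<lparr>carrier := k\<rparr>)"
    by (rule CC.subfield_iff(2)[OF k_subfield])
  interpret ring_hom_ring "CC\<lparr>carrier := k\<rparr>" B \<iota>
    using field.is_ring[OF field] ring_B embed_hom by (rule ring_hom_ringI2)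
  have "\<one>\<^bsub>B\<^esub> \<noteq> \<zero>\<^bsub>B\<^esub>"
    by (simp add: one_B embed_eq_zero_iff)
  from img_is_subfield(2)[OF _ this, of k] show ?thesis
    using field.carrier_is_subfield[OF field] by simp
qed

text \<open>The order is arbitrary; a list is chosen because \<open>k_basis\<close> takes
  one.\<close>

definition basis_indices :: "(nat \<times> (complex \<Rightarrow> complex)) list" where
  "basis_indices = (SOME basis_indices. set basis_indices = {..<m} \<times> carrier G \<and> distinct basis_indices)"

lemma basis_indices: "set basis_indices = {..<m} \<times> carrier G" "distinct basis_indices"
proof -
  have "\<exists>basis_indices. set basis_indices = {..<m} \<times> carrier G \<and> distinct basis_indices"
    by (rule finite_distinct_list) (simp add: finite_G)
  from someI_ex[OF this] show "set basis_indices = {..<m} \<times> carrier G" "distinct basis_indices"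
    by (auto simp: basis_indices_def)
qed

definition cp_basis :: "((complex \<Rightarrow> complex) \<Rightarrow> complex) list" where
  "cp_basis = map (\<lambda>(l, \<sigma>). mon (b l) \<sigma>) basis_indices"

text \<open>The coordinate at \<open>\<pi>\<close> sees only the monomials over
  \<open>\<pi>\<close>, so the claim splits into one copy of the basis property of \<open>b\<close>
  for each group element.\<close>

lemma k_basis_cp_basis: "k_basis B (\<iota> ` k) cp_basis"
  unfolding cp_basis_def
proof (rule k_basis_mapI[where \<Phi> = "(\<lambda>\<pi> x. x \<pi>) ` carrier G"])
  let ?\<Phi> = "(\<lambda>\<pi> x. x \<pi>) ` carrier G :: (((complex \<Rightarrow> complex) \<Rightarrow> complex) \<Rightarrow> complex) set"
  let ?v = "\<lambda>(l, \<sigma>). mon (b l) \<sigma>"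
  have sum: "(\<Sum>p\<in>set basis_indices. (\<iota> (d p) \<otimes>\<^bsub>B\<^esub> ?v p) \<pi>) = (\<Sum>l<m. d (l, \<pi>) * b l)"
    if "\<pi> \<in> carrier G" "\<And>p. p \<in> set basis_indices \<Longrightarrow> d p \<in> k" for \<pi> d
  proof -
    have "(\<Sum>p\<in>set basis_indices. (\<iota> (d p) \<otimes>\<^bsub>B\<^esub> ?v p) \<pi>) =
        (\<Sum>(l, \<sigma>)\<in>{..<m} \<times> carrier G. if \<pi> = \<sigma> then d (l, \<sigma>) * b l else 0)"
      using that by (intro sum.cong) (auto simp: basis_indices embed_mult_mon b_in_L mon_apply)
    also have "\<dots> = (\<Sum>l<m. \<Sum>\<sigma>\<in>carrier G. if \<pi> = \<sigma> then d (l, \<sigma>) * b l else 0)"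
      by (simp add: sum.cartesian_product)
    also have "\<dots> = (\<Sum>l<m. d (l, \<pi>) * b l)"
      using that finite_G by (simp add: sum.delta')
    finally show ?thesis .
  qed
  show "ring B" by (rule ring_B)
  show "subfield (\<iota> ` k) B" by (rule embed_k_subfield)
  show "distinct basis_indices" by (rule basis_indices)
  show "?v p \<in> carrier B" if "p \<in> set basis_indices" for p
    using that by (auto simp: basis_indices b_in_L mon_in_B)
  show "f (x \<oplus>\<^bsub>B\<^esub> y) = f x + f y" if "f \<in> ?\<Phi>" for f x y
    using that by (auto simp: add_B)
  show "x = y" if "x \<in> carrier B" "y \<in> carrier B" "\<And>f. f \<in> ?\<Phi> \<Longrightarrow> f x = f y" for x y
    using that(1,2) by (rule B_eqI) (use that(3) in auto)
  show "\<exists>c. c ` set basis_indices \<subseteq> \<iota> ` k \<and> (\<forall>f\<in>?\<Phi>. f x = (\<Sum>p\<in>set basis_indices. f (c p \<otimes>\<^bsub>B\<^esub> ?v p)))"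
    if x: "x \<in> carrier B" for x
  proof -
    have "\<forall>\<pi>\<in>carrier G. \<exists>c. (\<forall>i. c i \<in> k) \<and> x \<pi> = (\<Sum>i<m. c i * b i)"
      using b_span B_apply[OF x] by blast
    then obtain c where c: "\<And>\<pi> i. \<pi> \<in> carrier G \<Longrightarrow> c \<pi> i \<in> k"
      "\<And>\<pi>. \<pi> \<in> carrier G \<Longrightarrow> x \<pi> = (\<Sum>i<m. c \<pi> i * b i)"
      by metis
    define d where "d p = c (snd p) (fst p)" for p
    have d: "d p \<in> k" if "p \<in> set basis_indices" for p
      using that c(1) by (auto simp: d_def basis_indices)
    show ?thesis
      using sum[OF _ d] c(2) d by (intro exI[of _ "\<lambda>p. \<iota> (d p)"]) (auto simp: d_def)
  qed
  show "c p = \<zero>\<^bsub>B\<^esub>"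
    if c: "c ` set basis_indices \<subseteq> \<iota> ` k" and rel: "\<And>f. f \<in> ?\<Phi> \<Longrightarrow> (\<Sum>p\<in>set basis_indices. f (c p \<otimes>\<^bsub>B\<^esub> ?v p)) = 0"
      and p: "p \<in> set basis_indices" for c p
  proof -
    have "\<forall>p\<in>set basis_indices. \<exists>d\<in>k. c p = \<iota> d"
      using c by auto
    then obtain e where e: "\<And>p. p \<in> set basis_indices \<Longrightarrow> e p \<in> k \<and> c p = \<iota> (e p)" by metis
    \<comment> \<open>The value 0 off the list matters: \<open>b_indep\<close> asks for coefficients
      in \<open>k\<close> at every index.\<close>
    define d where "d p = (if p \<in> set basis_indices then e p else 0)" for p
    have d: "d p \<in> k" for p
      using e by (simp add: d_def subfield_CC(1)[OF k_subfield])
    obtain l \<pi> where l: "p = (l, \<pi>)" "l < m" "\<pi> \<in> carrier G"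
      using p by (auto simp: basis_indices)
    have "(\<Sum>p\<in>set basis_indices. (\<iota> (d p) \<otimes>\<^bsub>B\<^esub> ?v p) \<pi>) = (\<Sum>p\<in>set basis_indices. (c p \<otimes>\<^bsub>B\<^esub> ?v p) \<pi>)"
      by (intro sum.cong) (simp_all add: d_def e)
    also have "\<dots> = 0"
      using rel[of "\<lambda>x. x \<pi>"] l by simp
    finally have "(\<Sum>l<m. d (l, \<pi>) * b l) = 0"
      using sum[of \<pi> d] l d by simp
    then have "d (l, \<pi>) = 0"
      using b_indep[of "\<lambda>l. d (l, \<pi>)" l] d l(2) by blast
    then show ?thesis
      using e[OF p] p l(1) by (simp add: d_def embed_zero)
  qed
qed

text \<open>Parametrizing the factorizations of \<open>\<pi> \<otimes> inv \<rho>\<close> by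
  \<open>\<kappa>\<close> gives the convolution the shape of a matrix product with inner index
  \<open>\<kappa>\<close>.\<close>

lemma B_mult_apply:
  assumes "\<pi> \<in> carrier G" "\<rho> \<in> carrier G"
  shows "(x \<otimes>\<^bsub>B\<^esub> y) (\<pi> \<otimes>\<^bsub>G\<^esub> inv\<^bsub>G\<^esub> \<rho>) =
    (\<Sum>\<kappa>\<in>carrier G. x (\<pi> \<otimes>\<^bsub>G\<^esub> inv\<^bsub>G\<^esub> \<kappa>) * (\<pi> \<otimes>\<^bsub>G\<^esub> inv\<^bsub>G\<^esub> \<kappa>) (y (\<kappa> \<otimes>\<^bsub>G\<^esub> inv\<^bsub>G\<^esub> \<rho>)) *
      \<xi> (\<pi> \<otimes>\<^bsub>G\<^esub> inv\<^bsub>G\<^esub> \<kappa>) (\<kappa> \<otimes>\<^bsub>G\<^esub> inv\<^bsub>G\<^esub> \<rho>))"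
proof -
  have cancel: "(\<sigma> \<otimes>\<^bsub>G\<^esub> inv\<^bsub>G\<^esub> \<kappa>) \<otimes>\<^bsub>G\<^esub> (\<kappa> \<otimes>\<^bsub>G\<^esub> \<tau>) = \<sigma> \<otimes>\<^bsub>G\<^esub> \<tau>"
    "(\<sigma> \<otimes>\<^bsub>G\<^esub> \<kappa>) \<otimes>\<^bsub>G\<^esub> inv\<^bsub>G\<^esub> \<kappa> = \<sigma>" "(\<sigma> \<otimes>\<^bsub>G\<^esub> inv\<^bsub>G\<^esub> \<kappa>) \<otimes>\<^bsub>G\<^esub> \<kappa> = \<sigma>"
    if "\<sigma> \<in> carrier G" "\<kappa> \<in> carrier G" "\<tau> \<in> carrier G" for \<sigma> \<kappa> \<tau>
    using that by (simp_all add: m_assoc inv_solve_left flip: m_assoc[of "inv\<^bsub>G\<^esub> \<kappa>" \<kappa> \<tau>])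
  let ?S = "{(\<sigma>, \<tau>) \<in> carrier G \<times> carrier G. \<sigma> \<otimes>\<^bsub>G\<^esub> \<tau> = \<pi> \<otimes>\<^bsub>G\<^esub> inv\<^bsub>G\<^esub> \<rho>}"
  have "(x \<otimes>\<^bsub>B\<^esub> y) (\<pi> \<otimes>\<^bsub>G\<^esub> inv\<^bsub>G\<^esub> \<rho>) = (\<Sum>(\<sigma>, \<tau>)\<in>?S. x \<sigma> * \<sigma> (y \<tau>) * \<xi> \<sigma> \<tau>)"
    using assms by (simp add: crossed_product_def Let_def)
  also have "\<dots> = (\<Sum>\<kappa>\<in>carrier G. case (\<pi> \<otimes>\<^bsub>G\<^esub> inv\<^bsub>G\<^esub> \<kappa>, \<kappa> \<otimes>\<^bsub>G\<^esub> inv\<^bsub>G\<^esub> \<rho>) of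
      (\<sigma>, \<tau>) \<Rightarrow> x \<sigma> * \<sigma> (y \<tau>) * \<xi> \<sigma> \<tau>)"
  proof (rule sum.reindex_bij_witness[of _ "\<lambda>\<kappa>. (\<pi> \<otimes>\<^bsub>G\<^esub> inv\<^bsub>G\<^esub> \<kappa>, \<kappa> \<otimes>\<^bsub>G\<^esub> inv\<^bsub>G\<^esub> \<rho>)" "\<lambda>(\<sigma>, \<tau>). \<tau> \<otimes>\<^bsub>G\<^esub> \<rho>"])
    fix p assume "p \<in> ?S"
    then obtain \<sigma> \<tau> where p: "p = (\<sigma>, \<tau>)" "\<sigma> \<in> carrier G" "\<tau> \<in> carrier G"
      and eq: "\<sigma> \<otimes>\<^bsub>G\<^esub> \<tau> = \<pi> \<otimes>\<^bsub>G\<^esub> inv\<^bsub>G\<^esub> \<rho>"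
      by auto
    have "\<pi> = (\<sigma> \<otimes>\<^bsub>G\<^esub> \<tau>) \<otimes>\<^bsub>G\<^esub> \<rho>"
      unfolding eq using assms by (simp add: cancel)
    then have "\<pi> \<otimes>\<^bsub>G\<^esub> inv\<^bsub>G\<^esub> (\<tau> \<otimes>\<^bsub>G\<^esub> \<rho>) = \<sigma>"
      using p assms by (simp add: m_assoc cancel(2)[of \<sigma> "\<tau> \<otimes>\<^bsub>G\<^esub> \<rho>" \<tau>] flip: inv_mult_group)
    then show "(case p of (\<sigma>, \<tau>) \<Rightarrow> \<tau> \<otimes>\<^bsub>G\<^esub> \<rho>) \<in> carrier G"
      "(\<pi> \<otimes>\<^bsub>G\<^esub> inv\<^bsub>G\<^esub> (case p of (\<sigma>, \<tau>) \<Rightarrow> \<tau> \<otimes>\<^bsub>G\<^esub> \<rho>),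
        (case p of (\<sigma>, \<tau>) \<Rightarrow> \<tau> \<otimes>\<^bsub>G\<^esub> \<rho>) \<otimes>\<^bsub>G\<^esub> inv\<^bsub>G\<^esub> \<rho>) = p"
      using p assms by (simp_all add: cancel)
    then show "(case (\<pi> \<otimes>\<^bsub>G\<^esub> inv\<^bsub>G\<^esub> (case p of (\<sigma>, \<tau>) \<Rightarrow> \<tau> \<otimes>\<^bsub>G\<^esub> \<rho>),
        (case p of (\<sigma>, \<tau>) \<Rightarrow> \<tau> \<otimes>\<^bsub>G\<^esub> \<rho>) \<otimes>\<^bsub>G\<^esub> inv\<^bsub>G\<^esub> \<rho>) of
        (\<sigma>, \<tau>) \<Rightarrow> x \<sigma> * \<sigma> (y \<tau>) * \<xi> \<sigma> \<tau>) = (case p of (\<sigma>, \<tau>) \<Rightarrow> x \<sigma> * \<sigma> (y \<tau>) * \<xi> \<sigma> \<tau>)"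
      by simp
  qed (use assms in \<open>auto simp: cancel\<close>)
  finally show ?thesis by simp
qed

text \<open>
  The matrix of left multiplication by \<open>x\<close> on the right \<open>L\<close>-vector space with basis \<open>e\<^sub>\<rho>\<close>:
  \<open>x e\<^sub>\<rho> = \<Sum>\<^sub>\<pi> e\<^sub>\<pi> (entry x \<pi> \<rho>)\<close>.
\<close>

definition entry :: "((complex \<Rightarrow> complex) \<Rightarrow> complex) \<Rightarrow> (complex \<Rightarrow> complex) \<Rightarrow> (complex \<Rightarrow> complex) \<Rightarrow> complex" where
  "entry x \<pi> \<rho> = (inv\<^bsub>G\<^esub> \<pi>) (x (\<pi> \<otimes>\<^bsub>G\<^esub> inv\<^bsub>G\<^esub> \<rho>) * \<xi> (\<pi> \<otimes>\<^bsub>G\<^esub> inv\<^bsub>G\<^esub> \<rho>) \<rho>)"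

text \<open>Multiplicativity is the cocycle identity at the triple
  \<open>\<pi> \<otimes> inv \<kappa>\<close>, \<open>\<kappa> \<otimes> inv \<rho>\<close>,
  \<open>\<rho>\<close>, transported by \<open>inv \<pi>\<close>.\<close>

lemma entry_mult:
  assumes x: "x \<in> carrier B" and y: "y \<in> carrier B" and \<pi>: "\<pi> \<in> carrier G" and \<rho>: "\<rho> \<in> carrier G"
  shows "entry (x \<otimes>\<^bsub>B\<^esub> y) \<pi> \<rho> = (\<Sum>\<kappa>\<in>carrier G. entry x \<pi> \<kappa> * entry y \<kappa> \<rho>)"
proof -
  let ?s = "\<lambda>\<kappa>. \<pi> \<otimes>\<^bsub>G\<^esub> inv\<^bsub>G\<^esub> \<kappa>" and ?t = "\<lambda>\<kappa>. \<kappa> \<otimes>\<^bsub>G\<^esub> inv\<^bsub>G\<^esub> \<rho>"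
  have "entry (x \<otimes>\<^bsub>B\<^esub> y) \<pi> \<rho> = (inv\<^bsub>G\<^esub> \<pi>)
      (\<Sum>\<kappa>\<in>carrier G. x (?s \<kappa>) * (?s \<kappa>) (y (?t \<kappa>)) * \<xi> (?s \<kappa>) (?t \<kappa>) * \<xi> (?s \<rho>) \<rho>)"
    unfolding entry_def B_mult_apply[OF \<pi> \<rho>] by (simp add: sum_distrib_right)
  also have "\<dots> = (\<Sum>\<kappa>\<in>carrier G. (inv\<^bsub>G\<^esub> \<pi>)
      (x (?s \<kappa>) * (?s \<kappa>) (y (?t \<kappa>)) * \<xi> (?s \<kappa>) (?t \<kappa>) * \<xi> (?s \<rho>) \<rho>))"
    using \<pi> \<rho> by (intro gal_sum) (simp_all del: gal_mult_apply add: B_apply[OF x] B_apply[OF y])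
  also have "\<dots> = (\<Sum>\<kappa>\<in>carrier G. entry x \<pi> \<kappa> * entry y \<kappa> \<rho>)"
  proof (rule sum.cong[OF refl])
    fix \<kappa> assume \<kappa>: "\<kappa> \<in> carrier G"
    have s: "?s \<kappa> \<in> carrier G" and t: "?t \<kappa> \<in> carrier G"
      using \<pi> \<rho> \<kappa> by simp_all
    have yt: "y (?t \<kappa>) \<in> L" and xs: "x (?s \<kappa>) \<in> L"
      using x y s t by (simp_all add: B_apply)
    have st: "?s \<kappa> \<otimes>\<^bsub>G\<^esub> ?t \<kappa> = ?s \<rho>" "?t \<kappa> \<otimes>\<^bsub>G\<^esub> \<rho> = \<kappa>" "inv\<^bsub>G\<^esub> \<pi> \<otimes>\<^bsub>G\<^esub> ?s \<kappa> = inv\<^bsub>G\<^esub> \<kappa>"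
      using \<pi> \<rho> \<kappa> by (simp_all add: m_assoc flip: m_assoc[of "inv\<^bsub>G\<^esub> \<kappa>" \<kappa>] m_assoc[of "inv\<^bsub>G\<^esub> \<pi>" \<pi>])
    have "x (?s \<kappa>) * (?s \<kappa>) (y (?t \<kappa>)) * \<xi> (?s \<kappa>) (?t \<kappa>) * \<xi> (?s \<rho>) \<rho> =
        x (?s \<kappa>) * (?s \<kappa>) (y (?t \<kappa>)) * (\<xi> (?s \<kappa>) (?t \<kappa>) * \<xi> (?s \<kappa> \<otimes>\<^bsub>G\<^esub> ?t \<kappa>) \<rho>)"
      by (simp only: st mult.assoc)
    also have "\<dots> = x (?s \<kappa>) * (?s \<kappa>) (y (?t \<kappa>)) * ((?s \<kappa>) (\<xi> (?t \<kappa>) \<rho>) * \<xi> (?s \<kappa>) \<kappa>)"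
      by (simp only: cocycle[OF s t \<rho>] st(2))
    also have "\<dots> = (x (?s \<kappa>) * \<xi> (?s \<kappa>) \<kappa>) * (?s \<kappa>) (y (?t \<kappa>) * \<xi> (?t \<kappa>) \<rho>)"
      using gal_mult[OF s yt xi_in_L[OF t \<rho>]] by (simp only: mult_ac)
    finally have eq: "x (?s \<kappa>) * (?s \<kappa>) (y (?t \<kappa>)) * \<xi> (?s \<kappa>) (?t \<kappa>) * \<xi> (?s \<rho>) \<rho> =
        (x (?s \<kappa>) * \<xi> (?s \<kappa>) \<kappa>) * (?s \<kappa>) (y (?t \<kappa>) * \<xi> (?t \<kappa>) \<rho>)" .
    \<comment> \<open>Here \<open>inv \<pi>\<close> after \<open>?s \<kappa>\<close> is
      \<open>inv \<kappa>\<close>, the twist built into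
      \<open>entry y \<kappa> \<rho>\<close>.\<close>
    have "(inv\<^bsub>G\<^esub> \<pi>) ((?s \<kappa>) (y (?t \<kappa>) * \<xi> (?t \<kappa>) \<rho>)) = (inv\<^bsub>G\<^esub> \<kappa>) (y (?t \<kappa>) * \<xi> (?t \<kappa>) \<rho>)"
      using gal_mult_apply[OF inv_closed[OF \<pi>] s, of "y (?t \<kappa>) * \<xi> (?t \<kappa>) \<rho>"] st(3) yt t \<rho>
      by (simp del: gal_mult_apply)
    then show "(inv\<^bsub>G\<^esub> \<pi>) (x (?s \<kappa>) * (?s \<kappa>) (y (?t \<kappa>)) * \<xi> (?s \<kappa>) (?t \<kappa>) * \<xi> (?s \<rho>) \<rho>) =
        entry x \<pi> \<kappa> * entry y \<kappa> \<rho>"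
      unfolding eq entry_def
      using gal_mult[OF inv_closed[OF \<pi>] L_closed(4)[OF xs xi_in_L[OF s \<kappa>]]
          gal_in_L[OF s L_closed(4)[OF yt xi_in_L[OF t \<rho>]]]]
      by metis
  qed
  finally show ?thesis .
qed

lemma entry_add:
  assumes x: "x \<in> carrier B" and y: "y \<in> carrier B" and "\<pi> \<in> carrier G" "\<rho> \<in> carrier G"
  shows "entry (x \<oplus>\<^bsub>B\<^esub> y) \<pi> \<rho> = entry x \<pi> \<rho> + entry y \<pi> \<rho>"
  using assms
  by (simp add: entry_def add_B distrib_right B_apply del: gal_mult)

lemma entry_mon:
  assumes "\<pi> \<in> carrier G" "\<rho> \<in> carrier G"
  shows "entry (mon c \<sigma>) \<pi> \<rho> = (if \<pi> \<otimes>\<^bsub>G\<^esub> inv\<^bsub>G\<^esub> \<rho> = \<sigma> then (inv\<^bsub>G\<^esub> \<pi>) (c * \<xi> \<sigma> \<rho>) else 0)"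
  using assms by (simp add: entry_def mon_apply)

text \<open>On \<open>L\<close> the representation is diagonal and lists all conjugates; in
  particular elements of \<open>k\<close> become scalars.\<close>

lemma entry_embed:
  assumes "\<pi> \<in> carrier G" "\<rho> \<in> carrier G"
  shows "entry (\<iota> c) \<pi> \<rho> = (if \<pi> = \<rho> then (inv\<^bsub>G\<^esub> \<pi>) c else 0)"
proof -
  have "\<pi> \<otimes>\<^bsub>G\<^esub> inv\<^bsub>G\<^esub> \<rho> = \<one>\<^bsub>G\<^esub> \<longleftrightarrow> \<pi> = \<rho>"
    using assms by (metis inv_equality inv_inv r_inv inv_closed)
  then show ?thesis
    using assms by (simp add: embed_eq entry_mon xi_one_left[of \<rho>])
qed

section \<open>The regular representation splits \<open>B\<close> over the complex numbers\<close>

abbreviation n where "n \<equiv> card (carrier G)"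

definition enum_G :: "nat \<Rightarrow> complex \<Rightarrow> complex" where
  "enum_G = (SOME enum_G. bij_betw enum_G {..<n} (carrier G))"

lemma bij_enum_G: "bij_betw enum_G {..<n} (carrier G)"
  using someI_ex[OF ex_bij_betw_nat_finite[OF finite_G]] by (simp add: enum_G_def lessThan_atLeast0)

lemma enum_G_in_G [simp]: "i < n \<Longrightarrow> enum_G i \<in> carrier G"
  using bij_enum_G bij_betwE by blast

lemma enum_G_eq_iff: "i < n \<Longrightarrow> j < n \<Longrightarrow> enum_G i = enum_G j \<longleftrightarrow> i = j"
  using bij_enum_G by (auto simp: bij_betw_def inj_on_def)

lemma enum_G_surj: "\<sigma> \<in> carrier G \<Longrightarrow> \<exists>i<n. enum_G i = \<sigma>"
  using bij_enum_G by (metis bij_betw_def imageE lessThan_iff)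

definition regular_rep :: "((complex \<Rightarrow> complex) \<Rightarrow> complex) \<Rightarrow> complex mat" where
  "regular_rep x = mat n n (\<lambda>(i, j). entry x (enum_G i) (enum_G j))"

lemma regular_rep_embed: "c \<in> k \<Longrightarrow> regular_rep (\<iota> c) = c \<cdot>\<^sub>m 1\<^sub>m n"
  by (rule eq_matI) (auto simp: regular_rep_def entry_embed enum_G_eq_iff gal_fix)

lemma regular_rep_hom: "regular_rep \<in> Ring.ring_hom B (MM n)"
proof (rule Ring.ring_hom_memI)
  fix x y assume x: "x \<in> carrier B" and y: "y \<in> carrier B"
  show "regular_rep (x \<otimes>\<^bsub>B\<^esub> y) = regular_rep x \<otimes>\<^bsub>MM n\<^esub> regular_rep y"
  proof (rule eq_matI)
    fix i j assume "i < dim_row (regular_rep x \<otimes>\<^bsub>MM n\<^esub> regular_rep y)"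
      "j < dim_col (regular_rep x \<otimes>\<^bsub>MM n\<^esub> regular_rep y)"
    then have ij: "i < n" "j < n" by (simp_all add: ring_mat_simps regular_rep_def)
    have "regular_rep (x \<otimes>\<^bsub>B\<^esub> y) $$ (i, j) = (\<Sum>\<kappa>\<in>carrier G. entry x (enum_G i) \<kappa> * entry y \<kappa> (enum_G j))"
      using ij x y by (simp add: regular_rep_def entry_mult)
    also have "\<dots> = (\<Sum>l<n. entry x (enum_G i) (enum_G l) * entry y (enum_G l) (enum_G j))"
      by (rule sum.reindex_bij_betw[symmetric]) (rule bij_enum_G)
    finally show "regular_rep (x \<otimes>\<^bsub>B\<^esub> y) $$ (i, j) = (regular_rep x \<otimes>\<^bsub>MM n\<^esub> regular_rep y) $$ (i, j)"
      using ij by (simp add: ring_mat_simps regular_rep_def scalar_prod_def lessThan_atLeast0)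
  qed (simp_all add: regular_rep_def ring_mat_simps)
  show "regular_rep (x \<oplus>\<^bsub>B\<^esub> y) = regular_rep x \<oplus>\<^bsub>MM n\<^esub> regular_rep y"
    by (rule eq_matI) (simp_all add: regular_rep_def ring_mat_simps entry_add x y)
next
  show "regular_rep \<one>\<^bsub>B\<^esub> = \<one>\<^bsub>MM n\<^esub>"
  proof -
    have "1 \<cdot>\<^sub>m 1\<^sub>m n = (1\<^sub>m n :: complex mat)"
      by (rule eq_matI) auto
    then show ?thesis
      using regular_rep_embed[of 1] by (simp add: one_B ring_mat_simps subfield_CC(2)[OF k_subfield])
  qed
qed (simp add: regular_rep_def ring_mat_simps)

text \<open>Position \<open>(i, j)\<close> meets only the monomials over
  \<open>\<sigma> = enum_G i \<otimes> inv (enum_G j)\<close>. Up to a nonzero factor from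
  \<open>\<xi>\<close>, the entry there is
  \<open>\<Sum>l<m. d (l, \<sigma>) * \<kappa> (b l)\<close> with
  \<open>\<kappa> = inv (enum_G i)\<close>. For fixed \<open>\<sigma>\<close> each row contains
  exactly one such position, so \<open>\<kappa>\<close> runs through \<open>G\<close>. Spanning and
  independence thus reduce, one \<open>\<sigma>\<close> at a time, to
  \<open>evaluations_span\<close> and \<open>evaluations_independent\<close>.\<close>

lemma regular_rep_basis: "k_basis (MM n) (scalar_mats n) (map regular_rep cp_basis)"
proof -
  let ?v = "\<lambda>(l, \<sigma>). regular_rep (mon (b l) \<sigma>)"
  have map_eq: "map regular_rep cp_basis = map ?v basis_indices"
    by (simp add: cp_basis_def case_prod_beta)
  have sum: "(\<Sum>p\<in>set basis_indices. d p * ?v p $$ (i, j)) =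
      (\<Sum>l<m. d (l, enum_G i \<otimes>\<^bsub>G\<^esub> inv\<^bsub>G\<^esub> (enum_G j)) * (inv\<^bsub>G\<^esub> (enum_G i)) (b l)) *
        (inv\<^bsub>G\<^esub> (enum_G i)) (\<xi> (enum_G i \<otimes>\<^bsub>G\<^esub> inv\<^bsub>G\<^esub> (enum_G j)) (enum_G j))"
    if ij: "i < n" "j < n" for i j d
  proof -
    let ?\<sigma> = "enum_G i \<otimes>\<^bsub>G\<^esub> inv\<^bsub>G\<^esub> (enum_G j)"
    have "(\<Sum>p\<in>set basis_indices. d p * ?v p $$ (i, j)) =
        (\<Sum>(l, \<sigma>)\<in>{..<m} \<times> carrier G. if ?\<sigma> = \<sigma> then d (l, \<sigma>) * (inv\<^bsub>G\<^esub> (enum_G i)) (b l * \<xi> \<sigma> (enum_G j)) else 0)"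
      using ij by (intro sum.cong) (auto simp: basis_indices regular_rep_def entry_mon)
    also have "\<dots> = (\<Sum>l<m. \<Sum>\<sigma>\<in>carrier G.
        if ?\<sigma> = \<sigma> then d (l, \<sigma>) * (inv\<^bsub>G\<^esub> (enum_G i)) (b l * \<xi> \<sigma> (enum_G j)) else 0)"
      by (simp only: sum.cartesian_product)
    also have "\<dots> = (\<Sum>l<m. d (l, ?\<sigma>) * (inv\<^bsub>G\<^esub> (enum_G i)) (b l * \<xi> ?\<sigma> (enum_G j)))"
      using ij finite_G by (subst sum.delta') simp_all
    also have "\<dots> = (\<Sum>l<m. d (l, ?\<sigma>) * (inv\<^bsub>G\<^esub> (enum_G i)) (b l) * (inv\<^bsub>G\<^esub> (enum_G i)) (\<xi> ?\<sigma> (enum_G j)))"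
      using ij b_in_L by (intro sum.cong) (simp_all add: mult.assoc)
    finally show ?thesis by (simp add: sum_distrib_right)
  qed
  have xi: "(inv\<^bsub>G\<^esub> (enum_G i)) (\<xi> (enum_G i \<otimes>\<^bsub>G\<^esub> inv\<^bsub>G\<^esub> (enum_G j)) (enum_G j)) \<noteq> 0" if "i < n" "j < n" for i j
    using that by (simp add: gal_eq_0_iff)
  have index: "\<exists>j<n. enum_G i \<otimes>\<^bsub>G\<^esub> inv\<^bsub>G\<^esub> (enum_G j) = \<sigma>" if \<sigma>: "\<sigma> \<in> carrier G" "i < n" for i \<sigma>
  proof -
    obtain j where "j < n" "enum_G j = inv\<^bsub>G\<^esub> \<sigma> \<otimes>\<^bsub>G\<^esub> enum_G i"
      using enum_G_surj[of "inv\<^bsub>G\<^esub> \<sigma> \<otimes>\<^bsub>G\<^esub> enum_G i"] \<sigma> by auto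
    then show ?thesis
      using \<sigma> by (intro exI[of _ j]) (simp add: inv_mult_group flip: m_assoc)
  qed
  show ?thesis
    unfolding map_eq
  proof (rule k_basis_mat_mapI)
    show "n > 0" by (rule card_G_pos)
    show "distinct basis_indices" by (rule basis_indices)
    show "?v p \<in> carrier_mat n n" for p
      by (simp add: regular_rep_def case_prod_beta)
    show "\<exists>d. \<forall>i<n. \<forall>j<n. A $$ (i, j) = (\<Sum>p\<in>set basis_indices. d p * ?v p $$ (i, j))" for A
    proof -
      define idx where "idx = the_inv_into {..<n} enum_G"
      have idx: "idx (enum_G i) = i" if "i < n" for i
        unfolding idx_def using that bij_enum_G by (intro the_inv_into_f_f) (auto simp: bij_betw_def)
      \<comment> \<open>Decodes the position from \<open>\<sigma>\<close> and
        \<open>\<kappa>\<close>: the row belongs to \<open>inv \<kappa>\<close>, the column to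
        \<open>inv \<sigma> \<otimes> inv \<kappa>\<close>. Dividing by the factor from
        \<open>\<xi>\<close> leaves the values that the evaluations must interpolate.\<close>
      define w where "w \<sigma> \<kappa> = A $$ (idx (inv\<^bsub>G\<^esub> \<kappa>), idx (inv\<^bsub>G\<^esub> \<sigma> \<otimes>\<^bsub>G\<^esub> inv\<^bsub>G\<^esub> \<kappa>)) /
          \<kappa> (\<xi> \<sigma> (inv\<^bsub>G\<^esub> \<sigma> \<otimes>\<^bsub>G\<^esub> inv\<^bsub>G\<^esub> \<kappa>))" for \<sigma> \<kappa>
      have w: "w (enum_G i \<otimes>\<^bsub>G\<^esub> inv\<^bsub>G\<^esub> (enum_G j)) (inv\<^bsub>G\<^esub> (enum_G i)) =
          A $$ (i, j) / (inv\<^bsub>G\<^esub> (enum_G i)) (\<xi> (enum_G i \<otimes>\<^bsub>G\<^esub> inv\<^bsub>G\<^esub> (enum_G j)) (enum_G j))" if ij: "i < n" "j < n" for i j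
      proof -
        have "inv\<^bsub>G\<^esub> (enum_G i \<otimes>\<^bsub>G\<^esub> inv\<^bsub>G\<^esub> (enum_G j)) \<otimes>\<^bsub>G\<^esub> enum_G i = enum_G j"
          using ij by (simp add: inv_mult_group m_assoc)
        then show ?thesis
          using ij by (simp add: w_def idx)
      qed
      have "\<exists>c. \<forall>\<kappa>\<in>carrier G. w \<sigma> \<kappa> = (\<Sum>l<m. c l * \<kappa> (b l))" for \<sigma>
        by (rule evaluations_span) (simp_all add: finite_G)
      then obtain c where c: "\<And>\<sigma> \<kappa>. \<kappa> \<in> carrier G \<Longrightarrow> w \<sigma> \<kappa> = (\<Sum>l<m. c \<sigma> l * \<kappa> (b l))"
        by metis
      have "A $$ (i, j) = (\<Sum>p\<in>set basis_indices. c (snd p) (fst p) * ?v p $$ (i, j))" if ij: "i < n" "j < n" for i j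
      proof -
        have "(\<Sum>p\<in>set basis_indices. c (snd p) (fst p) * ?v p $$ (i, j)) =
            w (enum_G i \<otimes>\<^bsub>G\<^esub> inv\<^bsub>G\<^esub> (enum_G j)) (inv\<^bsub>G\<^esub> (enum_G i)) * (inv\<^bsub>G\<^esub> (enum_G i)) (\<xi> (enum_G i \<otimes>\<^bsub>G\<^esub> inv\<^bsub>G\<^esub> (enum_G j)) (enum_G j))"
          unfolding sum[OF ij] using ij by (subst c) simp_all
        also have "\<dots> = A $$ (i, j)"
          unfolding w[OF ij] using xi[OF ij] by (rule nonzero_eq_divide_eq[THEN iffD1, OF _ refl])
        finally show ?thesis ..
      qed
      then show ?thesis by (intro exI allI impI)
    qed
    show "d p = 0" if rel: "\<And>i j. i < n \<Longrightarrow> j < n \<Longrightarrow> (\<Sum>p\<in>set basis_indices. d p * ?v p $$ (i, j)) = 0"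
      and p: "p \<in> set basis_indices" for d p
    proof -
      obtain l \<sigma> where l: "p = (l, \<sigma>)" "l < m" "\<sigma> \<in> carrier G"
        using p by (auto simp: basis_indices)
      have "(\<Sum>l<m. d (l, \<sigma>) * \<kappa> (b l)) = 0" if \<kappa>: "\<kappa> \<in> carrier G" for \<kappa>
      proof -
        obtain i where i: "i < n" "enum_G i = inv\<^bsub>G\<^esub> \<kappa>"
          using enum_G_surj[of "inv\<^bsub>G\<^esub> \<kappa>"] \<kappa> by auto
        obtain j where j: "j < n" "enum_G i \<otimes>\<^bsub>G\<^esub> inv\<^bsub>G\<^esub> (enum_G j) = \<sigma>"
          using index[OF l(3) i(1)] by blast
        have "inv\<^bsub>G\<^esub> (enum_G i) = \<kappa>" using i \<kappa> by simp
        then show ?thesis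
          using rel[OF i(1) j(1)] xi[OF i(1) j(1)] unfolding sum[OF i(1) j(1)] j(2) by simp
      qed
      then show ?thesis
        unfolding l(1) by (rule evaluations_independent[OF _ l(2)])
    qed
  qed
qed

lemma regular_rep_splitting: "splitting k \<iota> B n regular_rep"
  using regular_rep_hom regular_rep_embed k_basis_cp_basis regular_rep_basis
  unfolding splitting_def Let_def scalar_mats_def by blast

text \<open>The same \<open>k\<close>-dimension of \<open>B\<close> is counted as
  \<open>N * N\<close> by an arbitrary splitting and as \<open>n * n\<close> by the regular
  representation.\<close>

lemma splitting_degree:
  assumes "splitting k \<iota> B N \<phi>"
  shows "N = n"
proof -
  interpret B: ring B by (rule ring_B)
  have dim_unique: "length cs = N' * N'"
    if "N' > 0" "k_basis (MM N') (scalar_mats N') (map \<psi> cs)"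
    for N' cs and \<psi> :: "((complex \<Rightarrow> complex) \<Rightarrow> complex) \<Rightarrow> complex mat"
  proof -
    interpret M: ring "MM N'" by (rule ring_mat)
    have "M.dimension (length cs) (scalar_mats N') (carrier (MM N'))"
      using that(2) M.dimensionI[of "scalar_mats N'" "map \<psi> cs"] scalar_mats_subfield[OF that(1)]
      by (simp add: k_basis_def)
    then show ?thesis
      using M.dimension_is_inj[OF scalar_mats_subfield[OF that(1)]] dimension_mat[OF that(1)] by blast
  qed
  obtain cs where cs: "k_basis B (\<iota> ` k) cs" "k_basis (MM N) (scalar_mats N) (map \<phi> cs)"
    using assms by (auto simp: splitting_def Let_def scalar_mats_def)
  \<comment> \<open>Dimension theory over the scalar matrices says nothing in degree 0. There the
    zero ring has only the empty basis, which would make \<open>B\<close> zero.\<close>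
  have "N > 0"
  proof (rule ccontr)
    interpret M: ring "MM N" by (rule ring_mat)
    assume "\<not> N > 0"
    then have "carrier (MM N) = {\<zero>\<^bsub>MM N\<^esub>}"
      by (auto simp: ring_mat_simps)
    then have "cs = []"
      using cs(2) M.independent_trivial_ring[of "scalar_mats N" "map \<phi> cs"] by (simp add: k_basis_def)
    then have "carrier B = {\<zero>\<^bsub>B\<^esub>}"
      using cs(1) by (simp add: k_basis_def)
    moreover have "\<iota> 1 \<in> carrier B"
      by (simp add: embed_in_B)
    ultimately show False
      by (simp add: embed_eq_zero_iff)
  qed
  have "length cs = length cp_basis"
    using cs(1) k_basis_cp_basis B.dimensionI[OF embed_k_subfield] B.dimension_is_inj[OF embed_k_subfield]
    unfolding k_basis_def by metis
  then have "N * N = n * n"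
    using dim_unique[OF \<open>N > 0\<close> cs(2)] dim_unique[OF card_G_pos regular_rep_basis] by simp
  then show ?thesis
    by (metis nat_mult_eq_cancel_disj power2_eq_square power2_eq_iff_nonneg zero_le)
qed

text \<open>Averaging over \<open>G\<close> avoids comparing two splittings directly: it moves the
  computation to an element of \<open>k\<close>, whose image every splitting prescribes.\<close>

lemma splitting_trace_embed:
  assumes \<phi>: "splitting k \<iota> B N \<phi>" and y: "y \<in> L"
  shows "(\<Sum>i<N. \<phi> (\<iota> y) $$ (i, i)) = trace y"
proof -
  define T where "T x = (\<Sum>i<N. \<phi> x $$ (i, i))" for x
  interpret B: ring B by (rule ring_B)
  have "N = n" using splitting_degree[OF \<phi>] .
  have hom: "\<phi> \<in> Ring.ring_hom B (MM N)" and scalar: "\<And>c. c \<in> k \<Longrightarrow> \<phi> (\<iota> c) = c \<cdot>\<^sub>m 1\<^sub>m N"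
    using \<phi> by (auto simp: splitting_def Let_def)
  have closed: "\<phi> x \<in> carrier_mat N N" if "x \<in> carrier B" for x
    using Ring.ring_hom_closed[OF hom that] by (simp add: ring_mat_simps)
  have mult: "\<phi> (x \<otimes>\<^bsub>B\<^esub> z) = \<phi> x * \<phi> z" if "x \<in> carrier B" "z \<in> carrier B" for x z
    using Ring.ring_hom_mult[OF hom that] by (simp add: ring_mat_simps)
  have T_add: "T (x \<oplus>\<^bsub>B\<^esub> z) = T x + T z" if "x \<in> carrier B" "z \<in> carrier B" for x z
    using Ring.ring_hom_add[OF hom that] closed[OF that(1)] closed[OF that(2)]
    by (simp add: ring_mat_simps T_def sum.distrib)
  have T_comm: "T (x \<otimes>\<^bsub>B\<^esub> z) = T (z \<otimes>\<^bsub>B\<^esub> x)" if "x \<in> carrier B" "z \<in> carrier B" for x z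
    unfolding T_def mult[OF that] mult[OF that(2,1)] using that by (intro mat_trace_comm closed)
  have conj: "T (\<iota> (\<sigma> y)) = T (\<iota> y)" if \<sigma>: "\<sigma> \<in> carrier G" for \<sigma>
  proof -
    let ?e = "mon 1 \<sigma>"
    have e: "?e \<in> carrier B" by (simp add: mon_in_B)
    have "?e \<sigma> \<noteq> \<zero>\<^bsub>B\<^esub> \<sigma>" using \<sigma> by (simp add: mon_apply zero_B)
    then have "?e \<noteq> \<zero>\<^bsub>B\<^esub>" by metis
    then have unit: "?e \<in> Units B"
      using skew e by (simp add: skew_field_def)
    note inv = B.Units_inv_closed[OF unit] B.Units_r_inv[OF unit] B.Units_l_inv[OF unit]
    have iy: "\<iota> y \<in> carrier B" "\<iota> (\<sigma> y) \<in> carrier B"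
      using \<sigma> y by (simp_all add: embed_in_B)
    \<comment> \<open>Since \<open>\<xi> \<sigma> 1 = \<sigma> (\<xi> 1 1)\<close>, the denominator
      in \<open>\<iota> y\<close> is absorbed on passing it through
      \<open>e_\<sigma>\<close>.\<close>
    have "\<sigma> (y / \<xi> \<one>\<^bsub>G\<^esub> \<one>\<^bsub>G\<^esub>) * \<sigma> (\<xi> \<one>\<^bsub>G\<^esub> \<one>\<^bsub>G\<^esub>) = \<sigma> (y / \<xi> \<one>\<^bsub>G\<^esub> \<one>\<^bsub>G\<^esub> * \<xi> \<one>\<^bsub>G\<^esub> \<one>\<^bsub>G\<^esub>)"
      using \<sigma> y by (intro gal_mult[symmetric]) simp_all
    then have "?e \<otimes>\<^bsub>B\<^esub> \<iota> y = mon (\<sigma> y) \<sigma>"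
      using \<sigma> y by (simp add: embed_eq mon_mult xi_one_right[OF \<sigma>])
    also have "\<dots> = \<iota> (\<sigma> y) \<otimes>\<^bsub>B\<^esub> ?e"
      using \<sigma> y by (simp add: embed_mult_mon)
    finally have comm: "?e \<otimes>\<^bsub>B\<^esub> \<iota> y = \<iota> (\<sigma> y) \<otimes>\<^bsub>B\<^esub> ?e" .
    have "T (\<iota> (\<sigma> y)) = T (\<iota> (\<sigma> y) \<otimes>\<^bsub>B\<^esub> ?e \<otimes>\<^bsub>B\<^esub> inv\<^bsub>B\<^esub> ?e)"
      using iy e inv by (simp add: B.m_assoc)
    also have "\<dots> = T (inv\<^bsub>B\<^esub> ?e \<otimes>\<^bsub>B\<^esub> (?e \<otimes>\<^bsub>B\<^esub> \<iota> y))"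
      unfolding comm using iy e inv by (intro T_comm) simp_all
    also have "\<dots> = T (\<iota> y)"
      using iy e inv by (simp flip: B.m_assoc)
    finally show ?thesis .
  qed
  have T_sum: "T (\<iota> (\<Sum>\<sigma>\<in>S. \<sigma> y)) = (\<Sum>\<sigma>\<in>S. T (\<iota> (\<sigma> y)))" if "S \<subseteq> carrier G" for S
  proof -
    have "finite S" using that finite_G finite_subset by blast
    then show ?thesis using that
    proof (induction S rule: finite_induct)
      case empty
      have "T (\<iota> 0) = T (\<iota> 0) + T (\<iota> 0)"
        using T_add[of "\<iota> 0" "\<iota> 0"] embed_add[of 0 0] by (simp add: embed_in_B)
      then show ?case by simp
    next
      case (insert \<sigma> S)
      have "(\<Sum>\<sigma>\<in>S. \<sigma> y) \<in> L"
        by (rule L_sum) (use insert.prems y in auto)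
      then show ?case
        using insert y by (simp add: embed_add T_add embed_in_B)
    qed
  qed
  \<comment> \<open>The factor \<open>n\<close> on the left counts conjugates; the one obtained at
    the end is the size of the scalar matrix, which equals \<open>n\<close> by
    \<open>splitting_degree\<close>.\<close>
  have "of_nat n * T (\<iota> y) = (\<Sum>\<sigma>\<in>carrier G. T (\<iota> (\<sigma> y)))"
    by (simp add: conj)
  also have "\<dots> = T (\<iota> (trace y))"
    by (simp add: T_sum trace_def)
  also have "\<dots> = of_nat n * trace y"
    unfolding T_def scalar[OF trace_in_k[OF y]] \<open>N = n\<close> by simp
  finally show ?thesis
    using card_G_pos by (simp add: T_def)
qed

lemma Trd_embed:
  assumes "y \<in> L"
  shows "Trd k \<iota> B (\<iota> y) = trace y"
  unfolding Trd_def
proof (rule the_equality)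
  show "\<exists>N \<phi>. splitting k \<iota> B N \<phi> \<and> trace y = (\<Sum>i<N. \<phi> (\<iota> y) $$ (i, i))"
    using regular_rep_splitting splitting_trace_embed[OF regular_rep_splitting assms] by metis
qed (use splitting_trace_embed assms in auto)

end

section \<open>Positivity\<close>

context galois_extension
begin

text \<open>Interpolation is applied to the set of all simultaneous limits. Sums and products of
  limits are limits, and constant sequences separate the automorphisms, so only constant functions
  need an argument.\<close>

lemma evaluations_dense:
  assumes fin: "finite (carrier G)" and z: "z \<in> k" "Im z \<noteq> 0"
  shows "\<exists>h. (\<forall>i. h i \<in> L) \<and> (\<forall>\<sigma>\<in>carrier G. (\<lambda>i. \<sigma> (h i)) \<longlonglongrightarrow> v \<sigma>)"
proof -
  define A where "A = {v. \<exists>h :: nat \<Rightarrow> complex. (\<forall>i. h i \<in> L) \<and> (\<forall>\<sigma>\<in>carrier G. (\<lambda>i. \<sigma> (h i)) \<longlonglongrightarrow> v \<sigma>)}"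
  have AI: "v \<in> A" if "\<And>i. h i \<in> L" "\<And>\<sigma>. \<sigma> \<in> carrier G \<Longrightarrow> (\<lambda>i. \<sigma> (h i)) \<longlonglongrightarrow> v \<sigma>" for h v
    using that unfolding A_def by blast
  have AE: "\<exists>h. (\<forall>i. h i \<in> L) \<and> (\<forall>\<sigma>\<in>carrier G. (\<lambda>i. \<sigma> (h i)) \<longlonglongrightarrow> v \<sigma>)" if "v \<in> A" for v
    using that unfolding A_def by blast
  have "\<exists>f\<in>A. \<forall>\<sigma>\<in>carrier G. f \<sigma> = v \<sigma>"
  proof (rule separating_algebra_interpolates[OF fin])
    show "(\<lambda>_. c) \<in> A" for c
    proof -
      \<comment> \<open>The two limits are the real coordinates of \<open>c\<close> in the basis
        \<open>1\<close>, \<open>z\<close> of the complex plane.\<close>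
      obtain p where p: "(\<forall>i. p i \<in> \<rat>) \<and> p \<longlonglongrightarrow> complex_of_real (Re c - Im c / Im z * Re z)"
        using Rats_approx by (rule exE)
      obtain q where q: "(\<forall>i. q i \<in> \<rat>) \<and> q \<longlonglongrightarrow> complex_of_real (Im c / Im z)"
        using Rats_approx by (rule exE)
      have "(\<lambda>i. p i + q i * z) \<longlonglongrightarrow> of_real (Re c - Im c / Im z * Re z) + of_real (Im c / Im z) * z"
        by (intro tendsto_intros p[THEN conjunct2] q[THEN conjunct2])
      also have "of_real (Re c - Im c / Im z * Re z) + of_real (Im c / Im z) * z = c"
        using z(2) by (simp add: complex_eq_iff)
      finally have lim: "(\<lambda>i. p i + q i * z) \<longlonglongrightarrow> c" .
      have in_k: "p i + q i * z \<in> k" for i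
        by (intro subfield_CC(3,4)[OF k_subfield] subfield_CC_Rats[OF k_subfield] p[THEN conjunct1, rule_format] q[THEN conjunct1, rule_format] z(1))
      show ?thesis
      proof (rule AI[of "\<lambda>i. p i + q i * z"])
        show "p i + q i * z \<in> L" for i using in_k by (rule k_in_L)
        \<comment> \<open>Elements of \<open>k\<close> are fixed by \<open>G\<close>, so one
          sequence serves all automorphisms.\<close>
        show "(\<lambda>i. \<sigma> (p i + q i * z)) \<longlonglongrightarrow> c" if "\<sigma> \<in> carrier G" for \<sigma>
          using lim gal_fix[OF that in_k] by presburger
      qed
    qed
    fix f1 f2 assume "f1 \<in> A" "f2 \<in> A"
    then obtain h1 h2 where h: "\<And>i. h1 i \<in> L" "\<And>\<sigma>. \<sigma> \<in> carrier G \<Longrightarrow> (\<lambda>i. \<sigma> (h1 i)) \<longlonglongrightarrow> f1 \<sigma>"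
      "\<And>i. h2 i \<in> L" "\<And>\<sigma>. \<sigma> \<in> carrier G \<Longrightarrow> (\<lambda>i. \<sigma> (h2 i)) \<longlonglongrightarrow> f2 \<sigma>"
      using AE by metis
    show "(\<lambda>\<sigma>. f1 \<sigma> + f2 \<sigma>) \<in> A"
      by (rule AI[of "\<lambda>i. h1 i + h2 i"]) (simp_all add: h tendsto_add)
    show "(\<lambda>\<sigma>. f1 \<sigma> * f2 \<sigma>) \<in> A"
      by (rule AI[of "\<lambda>i. h1 i * h2 i"]) (simp_all add: h tendsto_mult)
  next
    fix s t assume st: "s \<in> carrier G" "t \<in> carrier G" "s \<noteq> t"
    then obtain x where "x \<in> L" "s x \<noteq> t x"
      using gal_eqI[of s t] by blast
    then show "\<exists>f\<in>A. f s \<noteq> f t"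
      using AI[of "\<lambda>_. x" "\<lambda>\<sigma>. \<sigma> x"] by (intro bexI[of _ "\<lambda>\<sigma>. \<sigma> x"]) auto
  qed
  then obtain f where f: "f \<in> A" "\<And>\<sigma>. \<sigma> \<in> carrier G \<Longrightarrow> f \<sigma> = v \<sigma>" by blast
  then show ?thesis using AE[OF f(1)] by simp
qed

text \<open>\<open>bar\<close> is conjugation by \<open>cnj\<close>. It maps \<open>G\<close> to
  itself because \<open>cnj\<close> preserves both \<open>L\<close> and \<open>k\<close>, and the
  claim amounts to every \<open>\<sigma>\<close> being a fixed point of it.\<close>

lemma positive_trace_form_imp_commute:
  assumes fin: "finite (carrier G)" and z: "z \<in> k" "Im z \<noteq> 0"
    and cnj_L: "\<And>x. x \<in> L \<Longrightarrow> cnj x \<in> L" and cnj_k: "\<And>x. x \<in> k \<Longrightarrow> cnj x \<in> k"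
    and pos: "\<And>x. x \<in> L \<Longrightarrow> Re (trace (cnj x * x)) \<ge> 0"
    and \<sigma>: "\<sigma> \<in> carrier G" and x: "x \<in> L"
  shows "cnj (\<sigma> x) = \<sigma> (cnj x)"
proof -
  define bar where "bar \<rho> = (\<lambda>x\<in>L. cnj (\<rho> (cnj x)))" for \<rho> :: "complex \<Rightarrow> complex"
  have bar_apply: "bar \<rho> y = cnj (\<rho> (cnj y))" if "y \<in> L" for \<rho> y
    using that by (simp add: bar_def)
  have bar_in_G: "bar \<rho> \<in> carrier G" if \<rho>: "\<rho> \<in> carrier G" for \<rho>
  proof -
    have "bij_betw (bar \<rho>) L L"
    proof (rule bij_betwI[where g = "bar (inv\<^bsub>G\<^esub> \<rho>)"])
      show "bar \<rho> \<in> L \<rightarrow> L" "bar (inv\<^bsub>G\<^esub> \<rho>) \<in> L \<rightarrow> L"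
        using \<rho> by (auto simp: bar_apply cnj_L)
    qed (use \<rho> in \<open>simp_all add: bar_apply cnj_L\<close>)
    moreover have "bar \<rho> \<in> extensional L"
      by (simp add: bar_def)
    ultimately show ?thesis
      using \<rho> by (subst carrier_G) (simp add: bar_apply cnj_L gal_fix[OF \<rho> cnj_k])
  qed
  have bar_bar: "bar (bar \<rho>) = \<rho>" if \<rho>: "\<rho> \<in> carrier G" for \<rho>
    using \<rho> by (intro gal_eqI bar_in_G) (simp_all add: bar_apply cnj_L)
  have form: "trace (cnj y * y) = (\<Sum>\<rho>\<in>carrier G. cnj (bar \<rho> y) * \<rho> y)" if "y \<in> L" for y
    using that by (simp add: trace_def bar_apply cnj_L)
  have "bar \<sigma> = \<sigma>"
  proof (rule ccontr)
    assume ne: "bar \<sigma> \<noteq> \<sigma>"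
    define v :: "(complex \<Rightarrow> complex) \<Rightarrow> complex"
      where "v \<rho> = (if \<rho> = \<sigma> then 1 else if \<rho> = bar \<sigma> then -1 else 0)" for \<rho>
    \<comment> \<open>\<open>bar\<close> is an involution exchanging \<open>\<sigma>\<close> and
      \<open>bar \<sigma>\<close>, so \<open>v\<close> is odd under it, and the form at
      \<open>v\<close> is minus a sum of squares.\<close>
    have v_bar: "v (bar \<rho>) = - v \<rho>" if "\<rho> \<in> carrier G" for \<rho>
      using bar_bar[OF that] bar_bar[OF \<sigma>] ne by (auto simp: v_def)
    obtain h where h: "\<And>i. h i \<in> L" "\<And>\<rho>. \<rho> \<in> carrier G \<Longrightarrow> (\<lambda>i. \<rho> (h i)) \<longlonglongrightarrow> v \<rho>"
      using evaluations_dense[OF fin z, of v] by blast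
    have "(\<lambda>i. Re (\<Sum>\<rho>\<in>carrier G. cnj (bar \<rho> (h i)) * \<rho> (h i))) \<longlonglongrightarrow>
        Re (\<Sum>\<rho>\<in>carrier G. cnj (v (bar \<rho>)) * v \<rho>)"
      by (intro tendsto_intros h bar_in_G)
    moreover have "Re (\<Sum>\<rho>\<in>carrier G. cnj (bar \<rho> (h i)) * \<rho> (h i)) \<ge> 0" for i
      using pos[OF h(1)] form[OF h(1)] by simp
    ultimately have "Re (\<Sum>\<rho>\<in>carrier G. cnj (v (bar \<rho>)) * v \<rho>) \<ge> 0"
      by (intro tendsto_lowerbound[OF _ always_eventually]) auto
    moreover have "(\<Sum>\<rho>\<in>carrier G. cnj (v (bar \<rho>)) * v \<rho>) = - of_real (\<Sum>\<rho>\<in>carrier G. (cmod (v \<rho>))\<^sup>2)"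
      by (simp add: v_bar sum_negf complex_norm_square mult.commute del: of_real_power)
    \<comment> \<open>The summand at \<open>\<sigma>\<close> alone already puts the limit at or
      below -1.\<close>
    moreover have "(\<Sum>\<rho>\<in>carrier G. (cmod (v \<rho>))\<^sup>2) \<ge> (cmod (v \<sigma>))\<^sup>2"
      using fin \<sigma> by (intro member_le_sum) auto
    moreover have "v \<sigma> = 1" by (simp add: v_def)
    ultimately show False by simp
  qed
  then show ?thesis
    using bar_apply[of "cnj x" \<sigma>] x cnj_L by simp
qed

end

theorem proposition3p1:
  fixes k k0 L :: "complex set"
    and \<xi> :: "(complex \<Rightarrow> complex) \<Rightarrow> (complex \<Rightarrow> complex) \<Rightarrow> complex"
    and \<alpha> :: "complex \<Rightarrow> complex"
    and \<tau> :: "((complex \<Rightarrow> complex) \<Rightarrow> complex) \<Rightarrow> ((complex \<Rightarrow> complex) \<Rightarrow> complex)"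
  defines "G \<equiv> galois_group L k"
    and "B \<equiv> crossed_product \<xi> L k"
    and "\<iota> \<equiv> cp_embed \<xi> L k"
  assumes "number_field k0" and "number_field k" and "k0 \<subseteq> k"
    and "ring.dimension CC 2 k0 k"
    and "restrict cnj k \<in> carrier (galois_group k k0)"
    and "restrict cnj k \<noteq> \<one>\<^bsub>galois_group k k0\<^esub>"
    and "finite_galois_extension L k"
    and "two_cocycle L k \<xi>"
    and "skew_field B"
    and "\<alpha> = restrict cnj L" and "\<alpha> \<in> field_auts L"
    and "\<And>\<sigma> \<rho>. \<sigma> \<in> carrier G \<Longrightarrow> \<rho> \<in> carrier G \<Longrightarrow> \<alpha> (\<xi> \<sigma> \<rho>) * \<xi> \<sigma> \<rho> = 1"
    and "unitary_involution k \<iota> B \<tau>"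
    and "positive_involution k \<iota> B \<tau>"
    and "\<And>x. x \<in> L \<Longrightarrow> \<tau> (\<iota> x) = \<iota> (\<alpha> x)"
  shows "\<forall>\<sigma>\<in>carrier G. compose L \<alpha> \<sigma> = compose L \<sigma> \<alpha>"
proof -
  interpret ext: galois_extension L k
    by unfold_locales fact
  obtain m b where "galois_extension_basis L k m b"
    using ext.basis_exists by blast
  then interpret basis: galois_extension_basis L k m b .
  interpret cp: crossed_product_algebra L k m b \<xi>
    using assms by unfold_locales auto
  have cnj_L: "cnj x \<in> L" if "x \<in> L" for x
  proof -
    have "\<alpha> \<in> Ring.ring_hom (CC\<lparr>carrier := L\<rparr>) (CC\<lparr>carrier := L\<rparr>)"
      using \<open>\<alpha> \<in> field_auts L\<close> by (simp add: field_auts_def ring_iso_def)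
    from Ring.ring_hom_closed[OF this, of x] show ?thesis
      using that \<open>\<alpha> = restrict cnj L\<close> by simp
  qed
  have cnj_k: "cnj x \<in> k" if "x \<in> k" for x
  proof -
    have "restrict cnj k \<in> Ring.ring_hom (CC\<lparr>carrier := k\<rparr>) (CC\<lparr>carrier := k\<rparr>)"
      using \<open>restrict cnj k \<in> carrier (galois_group k k0)\<close>
      by (simp add: galois_group_def field_auts_def ring_iso_def)
    from Ring.ring_hom_closed[OF this, of x] show ?thesis
      using that by simp
  qed
  \<comment> \<open>Nontriviality of conjugation on \<open>k\<close> supplies the nonreal element
    needed for density in the complex plane.\<close>
  have "\<exists>z\<in>k. cnj z \<noteq> z"
  proof (rule ccontr)
    assume "\<not> (\<exists>z\<in>k. cnj z \<noteq> z)"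
    then have "restrict cnj k = (\<lambda>x\<in>k. x)"
      by (intro restrict_ext) blast
    then show False
      using \<open>restrict cnj k \<noteq> \<one>\<^bsub>galois_group k k0\<^esub>\<close> by (simp add: galois_group_def BijGroup_def)
  qed
  then obtain z where z: "z \<in> k" "Im z \<noteq> 0"
    by (auto simp: complex_eq_iff)
  have pos: "Re (ext.trace (cnj x * x)) \<ge> 0" if x: "x \<in> L" for x
  proof (cases "x = 0")
    case True
    then show ?thesis by (simp add: ext.trace_def)
  next
    case False
    then obtain r :: real where "r > 0" "Trd k \<iota> B (\<tau> (\<iota> x) \<otimes>\<^bsub>B\<^esub> \<iota> x) = of_real r"
      using \<open>positive_involution k \<iota> B \<tau>\<close> x cp.embed_in_B[OF x] cp.embed_eq_zero_iff[of x]
      unfolding positive_involution_def B_def \<iota>_def by blast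
    \<comment> \<open>Because \<open>\<tau>\<close> restricts to conjugation on \<open>L\<close>,
      this product stays in the embedded \<open>L\<close>, where \<open>Trd\<close> has been
      computed.\<close>
    moreover have "\<tau> (\<iota> x) \<otimes>\<^bsub>B\<^esub> \<iota> x = \<iota> (cnj x * x)"
      using assms(18)[OF x] x cnj_L \<open>\<alpha> = restrict cnj L\<close>
      by (simp add: cp.embed_mult B_def \<iota>_def)
    moreover have "Trd k \<iota> B (\<iota> (cnj x * x)) = ext.trace (cnj x * x)"
      unfolding B_def \<iota>_def by (rule cp.Trd_embed) (simp add: x cnj_L)
    ultimately show ?thesis by simp
  qed
  show ?thesis
  proof
    fix \<sigma> assume "\<sigma> \<in> carrier G"
    then have \<sigma>: "\<sigma> \<in> carrier (galois_group L k)" by (simp add: G_def)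
    have "cnj (\<sigma> x) = \<sigma> (cnj x)" if "x \<in> L" for x
      by (rule ext.positive_trace_form_imp_commute[OF basis.finite_G z cnj_L cnj_k pos \<sigma> that])
    then show "compose L \<alpha> \<sigma> = compose L \<sigma> \<alpha>"
      using \<sigma> \<open>\<alpha> = restrict cnj L\<close> by (auto simp: compose_def cnj_L intro!: restrict_ext)
  qed
qed

end
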